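(* For integers $\alpha,\beta\ge 0$ define $$F_{\alpha,\beta}(z)=\frac{1}{z^{2^\alpha}}\sum_{n\ge0}\frac{z^{2^{n+\alpha}}}{1+z^{2^{n+\beta}}},\qquad G_{\alpha,\beta}(z)=\frac{1}{z^{2^\alpha}}\sum_{n\ge0}\frac{z^{2^{n+\alpha}}}{1-z^{2^{n+\beta}}}.$$ Let $\alpha,\beta\ge 0$ be integers with $\beta\neq\alpha+1$, and let $b\ge 2$ be an integer. Then $F_{\alpha,\beta}(1/b)$ and $G_{\alpha,\beta}(1/b)$ are both transcendental, and their irrationality exponents are equal to $2$.
   Context: The irrationality exponent $\mu(\xi)$ of an irrational real number $\xi$ is the supremum of the real numbers $\mu$ such that $|\xi-p/q|<q^{-\mu}$ has infinitely many solutions in rational numbers $p/q$. *)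

theory Defs
  imports "HOL-Analysis.Analysis" "HOL-Computational_Algebra.Polynomial"
begin

definition F_ab :: "nat \<Rightarrow> nat \<Rightarrow> real \<Rightarrow> real" where
  "F_ab \<alpha> \<beta> z = (1 / z ^ (2 ^ \<alpha>)) *
     (\<Sum>n. z ^ (2 ^ (n + \<alpha>)) / (1 + z ^ (2 ^ (n + \<beta>))))"

definition G_ab :: "nat \<Rightarrow> nat \<Rightarrow> real \<Rightarrow> real" where
  "G_ab \<alpha> \<beta> z = (1 / z ^ (2 ^ \<alpha>)) *
     (\<Sum>n. z ^ (2 ^ (n + \<alpha>)) / (1 - z ^ (2 ^ (n + \<beta>))))"

definition irrationality_exponent :: "real \<Rightarrow> ereal" where
  "irrationality_exponent \<xi> = Sup {ereal \<mu> | \<mu>.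
     infinite {pq :: int \<times> int. let p = fst pq; q = snd pq in q > 0 \<and> coprime p q \<and>
                 \<bar>\<xi> - of_int p / of_int q\<bar> < (of_int q) powr (- \<mu>)}}"

end

theory Submission
  imports Defs "Jordan_Normal_Form.Char_Poly" "HOL-Library.Z2"
    "HOL-Analysis.Kronecker_Approximation_Theorem" "HOL-Real_Asymp.Real_Asymp"
begin

text \<open>
  With \<open>e = 1\<close> for \<open>F\<close> and \<open>e = -1\<close> for \<open>G\<close>, put \<open>r(z) = z^(2^\<alpha>) / (1 + e z^(2^\<beta>))\<close> and
  \<open>S(z) = \<Sum>n. r(z^(2^n))\<close>, so that \<open>S(z) = r(z) + S(z\<^sup>2)\<close>. Modulo 2 this becomes the Artin--Schreier
  equation \<open>S\<^sup>2 + S = r\<close>, which has no solution in \<open>\<bbbF>\<^sub>2(z)\<close> exactly when \<open>\<beta> \<noteq> \<alpha> + 1\<close>.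
  If \<open>P, Q\<close> are integer polynomials of degree at most \<open>K\<close>, not both zero modulo 2, the norm of
  \<open>Q S - P\<close> modulo 2 is a nonzero polynomial of degree at most \<open>2 K + O(1)\<close>. Hence a Pade remainder
  \<open>Q S - P\<close> vanishes at 0 to order \<open>2 K + O(1)\<close> and no more. Evaluating it at \<open>b^(-2^m)\<close> and
  iterating the functional equation yields rational approximations to \<open>S(1/b)\<close> whose quality is known
  up to a factor and whose denominators leave only small gaps on a logarithmic scale. This forces the
  irrationality exponent to be 2.

  For the transcendence, Mahler's method is applied to an auxiliary polynomial in \<open>z\<close> and \<open>S(z)\<close>.
  An algebraic relation for the function \<open>S\<close> of minimal degree would give a rational solution of
  \<open>a(z) = a(z\<^sup>2) + r(z)\<close>, and this is again excluded modulo 2.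
\<close>

text \<open>The prime 2 is the natural modulus: over F_2 the substitution of z^2 for z is squaring,
  so a functional equation turns into an algebraic one. It also treats \<open>F\<close> and
  \<open>G\<close> alike, since 1 and -1 agree modulo 2. For \<beta> = \<alpha> + 1 and u =
  z^(2^\<alpha>), the function 1 / (1 + u) solves the reduced equation, because 1 / (1 + u)^2 + 1 /
  (1 + u) = u / (1 + u^2) modulo 2; with e = -1 the sum S itself even telescopes to u / (1 - u).

  The obstacle is that linear algebra bounds the order of a Pade remainder only from below, and a
  remainder of uncontrolled order would leave gaps in the sequence of approximations. The norm
  supplies an upper bound for every K, with the same defect 2^\<alpha> + 2^\<beta>.

  Power series are replaced by integer polynomials that agree with the real function S up to O(x^N)
  as x tends to 0 from the right.\<close>

hide_const (open) Module.smult

section \<open>Artin--Schreier equations modulo 2\<close>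

text \<open>Characteristic 2 enters here: the ring computations below collect their cancelling terms
  into an explicit multiple of 2, which this rule removes.\<close>

lemma bit_poly_two [simp]: "(2 :: bit poly) = 0"
  by (simp add: numeral_poly)

lemma bit_poly_add_self: "p + p = (0 :: bit poly)"
  using mult_2[of p] by simp

lemma bit_poly_eqI: "p + q = 0 \<Longrightarrow> p = (q :: bit poly)"
  by (metis add.assoc add.right_neutral add_0 bit_poly_add_self)

text \<open>Frobenius: for p = a + z p' the cross term of the square carries a factor 2, and both
  elements a of the field satisfy a^2 = a.\<close>

lemma bit_poly_square: "p\<^sup>2 = pcompose p (monom 1 2)" for p :: "bit poly"
proof (induction p)
  case (pCons a p)
  have "pCons a p = [:a:] + monom 1 1 * p"
    by (simp add: monom_Suc)
  moreover have "([:a:] + monom 1 1 * p)\<^sup>2 = [:a:]\<^sup>2 + (monom 1 1)\<^sup>2 * p\<^sup>2 + 2 * ([:a:] * monom 1 1 * p)"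
    by (simp only: power2_sum power_mult_distrib mult.assoc)
  moreover have "[:a:]\<^sup>2 = [:a:]" "(monom (1::bit) 1)\<^sup>2 = monom 1 2"
    by (cases a; simp add: power2_eq_square) (simp add: monom_power)
  ultimately have "(pCons a p)\<^sup>2 = [:a:] + monom 1 2 * p\<^sup>2"
    by simp
  then show ?case
    using pCons.IH by (simp add: pcompose_pCons)
qed (simp_all add: power2_eq_square)

text \<open>In terms of \<open>T = P / Q\<close> the equation reads \<open>T\<^sup>2 + T = - W / (z - a)^M\<close>, but every pole of
  \<open>T\<^sup>2 + T\<close> has even order.\<close>

lemma artin_schreier_odd_pole:
  fixes P Q W :: "'a :: idom poly"
  assumes "odd M" "poly W a \<noteq> 0"
    and eq: "P\<^sup>2 * [:-a, 1:] ^ M + P * Q * [:-a, 1:] ^ M + Q\<^sup>2 * W = 0"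
  shows "Q = 0"
proof (rule ccontr)
  assume Q: "Q \<noteq> 0"
  define X where "X = [:-a, 1:]"
  define p q where "p = order a P" and "q = order a Q"
  have W: "W \<noteq> 0" "order a W = 0"
    using assms(2) by (auto simp: order_0I)
  have P: "P \<noteq> 0"
    using eq Q W by auto
  have Xp: "X ^ p dvd P" "X ^ q dvd Q"
    by (simp_all add: X_def p_def q_def order_1)
  have nz: "X ^ M \<noteq> 0"
    by (simp add: X_def)
  have A: "X ^ k dvd P\<^sup>2 * X ^ M \<longleftrightarrow> k \<le> 2 * p + M" for k
    using P nz by (simp add: X_def order_divides order_mult p_def power2_eq_square order_power_n_n mult_2)
  have B: "X ^ (p + q + M) dvd P * Q * X ^ M"
    using Xp by (simp add: power_add mult_dvd_mono)
  have C: "X ^ k dvd Q\<^sup>2 * W \<longleftrightarrow> k \<le> 2 * q" for k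
    using Q W by (simp add: X_def order_divides order_mult q_def power2_eq_square mult_2)
  have eq': "P\<^sup>2 * X ^ M + P * Q * X ^ M + Q\<^sup>2 * W = 0"
    using eq by (simp add: X_def)
  have "M > 0" "2 * q \<noteq> 2 * p + M"
    using \<open>odd M\<close> by (auto simp: odd_pos) presburger
  \<comment> \<open>The orders at \<open>a\<close> of the outer terms, 2p + M and 2q, differ by
    parity, and the middle term has order at least p + q + M. The smaller outer order is strictly
    below the other two, so the three terms cannot cancel.\<close>
  then consider "2 * q < 2 * p + M" "q < p + M" | "2 * q > 2 * p + M"
    by linarith
  then show False
  proof cases
    case 1
    then have "X ^ Suc (2 * q) dvd P\<^sup>2 * X ^ M"
      unfolding A by linarith
    moreover have "X ^ Suc (2 * q) dvd P * Q * X ^ M"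
      by (rule dvd_trans[OF le_imp_power_dvd B]) (use 1 in linarith)
    ultimately have "X ^ Suc (2 * q) dvd - (P\<^sup>2 * X ^ M + P * Q * X ^ M)"
      by simp
    also have "- (P\<^sup>2 * X ^ M + P * Q * X ^ M) = Q\<^sup>2 * W"
      using eq' by (rule minus_unique)
    finally show False
      using C[of "Suc (2 * q)"] by simp
  next
    case 2
    then have "X ^ Suc (2 * p + M) dvd Q\<^sup>2 * W"
      unfolding C by linarith
    moreover have "X ^ Suc (2 * p + M) dvd P * Q * X ^ M"
      by (rule dvd_trans[OF le_imp_power_dvd B]) (use 2 in linarith)
    ultimately have "X ^ Suc (2 * p + M) dvd - (P * Q * X ^ M + Q\<^sup>2 * W)"
      by simp
    also have "- (P * Q * X ^ M + Q\<^sup>2 * W) = P\<^sup>2 * X ^ M"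
      by (rule minus_unique) (use eq' in \<open>simp only: ac_simps\<close>)
    finally show False
      using A[of "Suc (2 * p + M)"] by simp
  qed
qed

text \<open>The witness is \<open>s = X^(2^k) (X^(-1) + X^(-2) + X^(-4) + \<dots> + X^(-2^k))\<close>. Adding \<open>s / X^(2^k)\<close> to \<open>T\<close>
  changes \<open>T\<^sup>2 + T\<close> by \<open>X^(-1) + X^(-2^(k+1))\<close>, which removes a pole of even order.\<close>

lemma artin_schreier_shift:
  fixes X :: "bit poly"
  shows "\<exists>s. s\<^sup>2 + s * X ^ 2 ^ k = 1 + X ^ (2 ^ Suc k - 1)"
proof (induction k)
  case 0
  show ?case
    by (rule exI[of _ 1]) simp
next
  case (Suc k)
  then obtain s where s: "s\<^sup>2 + s * X ^ 2 ^ k = 1 + X ^ (2 ^ Suc k - 1)"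
    by blast
  define h where "h = X ^ 2 ^ k"
  have h2: "X ^ 2 ^ Suc k = h\<^sup>2"
    by (simp add: h_def power_mult [symmetric] mult.commute)
  \<comment> \<open>Passing from k to k + 1 multiplies the witness by another X^(2^k) and appends
    the term X^(2^(k+1)) X^(-2^(k+1)) = 1, whence \<open>h * s + 1\<close>.\<close>
  have "(h * s + 1)\<^sup>2 + (h * s + 1) * h\<^sup>2 = h\<^sup>2 * (s\<^sup>2 + s * h) + 1 + h\<^sup>2 + 2 * (h * s)"
    by (simp add: algebra_simps power2_eq_square)
  also have "\<dots> = h\<^sup>2 * (1 + X ^ (2 ^ Suc k - 1)) + 1 + h\<^sup>2"
    using s by (simp add: h_def)
  also have "\<dots> = h\<^sup>2 * X ^ (2 ^ Suc k - 1) + 1 + 2 * h\<^sup>2"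
    by (simp only: algebra_simps mult_2 mult_1_left mult_1_right)
  also have "\<dots> = X ^ 2 ^ Suc k * X ^ (2 ^ Suc k - 1) + 1"
    by (simp only: h2 bit_poly_two mult_zero_left add_0_right)
  also have "X ^ 2 ^ Suc k * X ^ (2 ^ Suc k - 1) = X ^ (2 ^ Suc (Suc k) - 1)"
  proof -
    have "(2::nat) ^ Suc k + (2 ^ Suc k - 1) = 2 ^ Suc (Suc k) - 1"
      using one_le_power[of "2::nat" k] by (simp del: one_le_power)
    then show ?thesis
      by (metis power_add)
  qed
  finally show ?case
    using h2 by (intro exI[of _ "h * s + 1"]) (simp add: add.commute)
qed

text \<open>Since \<open>r\<close> is a square modulo 2 when \<open>\<alpha>, \<beta> > 0\<close>, replacing \<open>T = P / Q\<close> by \<open>T + \<surd>r\<close> lowers both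
  \<open>\<alpha>\<close> and \<open>\<beta>\<close> by one.\<close>

lemma bit_norm_nonzero:
  fixes P Q :: "bit poly"
  assumes "\<beta> \<noteq> \<alpha> + 1"
    and "P\<^sup>2 * [:1, 1:] ^ 2 ^ \<beta> + P * Q * [:1, 1:] ^ 2 ^ \<beta> + Q\<^sup>2 * monom 1 (2 ^ \<alpha>) = 0"
  shows "Q = 0"
  using assms
proof (induction \<alpha> arbitrary: \<beta> P Q)
  case (0 \<beta>)
  note eq = 0(2)
  have X: "[:-1, 1:] = [:1, 1::bit:]"
    by simp
  show ?case
  proof (cases \<beta>)
    case 0
    show ?thesis
      by (rule artin_schreier_odd_pole[of 1 "monom 1 (2 ^ 0)" 1 P])
        (use eq 0 in \<open>simp_all add: poly_monom\<close>)
  next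
    case (Suc k)
    define X where "X = [:1, 1::bit:]"
    define h where "h = X ^ 2 ^ k"
    \<comment> \<open>As z = 1 + X, here r = X^(-2^(k+1)) + X^(-M). Adding s / h to P / Q turns this
      into X^(-1) + X^(-M), whose pole has odd order M because M > 1. For k = 0, that is \<beta> =
      \<alpha> + 1, the two terms would cancel.\<close>
    define M :: nat where "M = 2 ^ Suc k - 1"
    have k: "k > 0"
      using Suc 0(1) by auto
    have "(2::nat) ^ Suc k \<ge> 2 ^ 2"
      using k by (intro power_increasing) auto
    then have M: "odd M" "M > 1" "Suc M = 2 ^ Suc k"
      by (auto simp: M_def)
    obtain s where s: "s\<^sup>2 + s * h = 1 + X ^ M"
      using artin_schreier_shift[of X k] by (auto simp: h_def M_def)
    have h2: "h\<^sup>2 = X ^ Suc M"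
      unfolding M(3) by (simp add: h_def power_mult [symmetric] mult.commute)
    have z: "monom 1 (Suc 0) = 1 + X"
      by (simp add: X_def monom_Suc one_pCons)
    have "X ^ 2 ^ \<beta> = h\<^sup>2"
      using h2 M(3) Suc by simp
    then have "P\<^sup>2 * h\<^sup>2 + P * Q * h\<^sup>2 + Q\<^sup>2 * (1 + X) = 0"
      using eq by (simp add: X_def [symmetric] z)
    then have eq': "P\<^sup>2 * h\<^sup>2 + P * Q * h\<^sup>2 = Q\<^sup>2 * (1 + X)"
      by (rule bit_poly_eqI)
    define P' Q' where "P' = P * h + Q * s" and "Q' = Q * h"
    have "P'\<^sup>2 + P' * Q' = P\<^sup>2 * h\<^sup>2 + P * Q * h\<^sup>2 + Q\<^sup>2 * (s\<^sup>2 + s * h) + 2 * (P * h * Q * s)"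
      by (simp add: P'_def Q'_def algebra_simps power2_eq_square)
    also have "\<dots> = Q\<^sup>2 * (1 + X) + Q\<^sup>2 * (1 + X ^ M)"
      by (simp add: eq' s)
    also have "\<dots> = Q\<^sup>2 * (X + X ^ M) + 2 * Q\<^sup>2"
      by (simp only: algebra_simps mult_2 mult_1_left mult_1_right)
    also have "\<dots> = Q\<^sup>2 * X * (1 + X ^ (M - 1))"
      using M(2) by (simp add: algebra_simps flip: power_Suc)
    finally have "(P'\<^sup>2 + P' * Q') * X ^ M = Q\<^sup>2 * X * (1 + X ^ (M - 1)) * X ^ M"
      by simp
    also have "\<dots> = Q'\<^sup>2 * (1 + X ^ (M - 1))"
      by (simp add: Q'_def power_mult_distrib h2 algebra_simps)
    finally have "P'\<^sup>2 * X ^ M + P' * Q' * X ^ M + Q'\<^sup>2 * (1 + X ^ (M - 1))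
        = 2 * (Q'\<^sup>2 * (1 + X ^ (M - 1)))"
      by (simp only: distrib_right mult_2)
    then have eq'': "P'\<^sup>2 * X ^ M + P' * Q' * X ^ M + Q'\<^sup>2 * (1 + X ^ (M - 1)) = 0"
      by (simp only: bit_poly_two mult_zero_left)
    have X1: "[:-1, 1:] = X"
      by (simp add: X_def)
    have "poly (1 + X ^ (M - 1)) 1 \<noteq> 0"
      using M(2) by (simp add: X_def power_0_left)
    then have "Q' = 0"
      using eq'' artin_schreier_odd_pole[OF M(1), of "1 + X ^ (M - 1)" 1 P' Q'] unfolding X1 by blast
    then show ?thesis
      by (auto simp: Q'_def h_def X_def)
  qed
next
  case (Suc \<alpha> \<beta>)
  note eq = Suc.prems(2)
  show ?case
  proof (cases \<beta>)
    case 0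
    show ?thesis
      by (rule artin_schreier_odd_pole[of 1 "monom 1 (2 ^ Suc \<alpha>)" 1 P])
        (use eq 0 in \<open>simp_all add: poly_monom\<close>)
  next
    case (Suc k)
    define y u where "y = [:1, 1::bit:] ^ 2 ^ k" and "u = monom (1::bit) (2 ^ \<alpha>)"
    have y2: "[:1, 1::bit:] ^ 2 ^ \<beta> = y\<^sup>2"
      by (simp add: y_def Suc power_mult [symmetric] mult.commute)
    have u2: "monom (1::bit) (2 ^ Suc \<alpha>) = u\<^sup>2"
      by (simp add: u_def monom_power mult.commute)
    have "(P * y + Q * u)\<^sup>2 * y + (P * y + Q * u) * (Q * y) * y + (Q * y)\<^sup>2 * u
        = y * (P\<^sup>2 * y\<^sup>2 + P * Q * y\<^sup>2 + Q\<^sup>2 * u\<^sup>2) + 2 * (P * Q * y\<^sup>2 * u + Q\<^sup>2 * y\<^sup>2 * u)"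
      by (simp add: algebra_simps power2_eq_square)
    also have "\<dots> = 0"
      using eq by (simp only: y2 u2 bit_poly_two mult_zero_left mult_zero_right add_0_right)
    finally have eq': "(P * y + Q * u)\<^sup>2 * y + (P * y + Q * u) * (Q * y) * y + (Q * y)\<^sup>2 * u = 0" .
    have "k \<noteq> \<alpha> + 1"
      using Suc Suc.prems(1) by simp
    from Suc.IH[OF this, folded y_def u_def, OF eq'] have "Q * y = 0" .
    then show ?thesis
      by (simp add: y_def)
  qed
qed

section \<open>Integer polynomials and their reduction modulo 2\<close>

abbreviation red :: "int poly \<Rightarrow> bit poly" where "red \<equiv> of_int_poly"

lemma of_int_bit_eq_0_iff: "(of_int n :: bit) = 0 \<longleftrightarrow> even n"
proof (cases "even n")
  case False
  then obtain k where "n = 2 * k + 1"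
    by (elim oddE)
  then have "(of_int n :: bit) = 1"
    by (simp only: of_int_add of_int_mult) simp
  then show ?thesis
    using False by simp
qed (auto elim!: evenE)

lemma monom_1_dvd_monom_1: "k \<le> n \<Longrightarrow> monom 1 k dvd (monom 1 n :: 'a :: comm_semiring_1 poly)"
  by (metis dvd_triv_left le_add_diff_inverse mult_1 mult_monom)

lemma smult_left_cancel: "smult c p = smult c q \<Longrightarrow> c \<noteq> 0 \<Longrightarrow> p = (q :: int poly)"
  by (simp add: poly_eq_iff)

lemma red_eq_0E:
  assumes "red p = 0"
  obtains p' where "p = smult 2 p'"
proof -
  have "\<forall>i. even (coeff p i)"
    using assms by (metis coeff_0 of_int_bit_eq_0_iff of_int_hom.coeff_map_poly_hom)
  then have "[:2:] dvd p"
    by (simp add: const_poly_dvd_iff)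
  then show thesis
    by (elim dvdE) (auto intro: that)
qed

text \<open>Common factors 2 are divided out; each division halves the sum of the absolute leading
  coefficients, which is positive for a nonzero pair. The exponent is shared, so the quotient P / Q
  does not change.\<close>

lemma red_decomp_pair:
  assumes "P \<noteq> 0 \<or> Q \<noteq> (0 :: int poly)"
  obtains j P' Q' where "P = smult (2 ^ j) P'" "Q = smult (2 ^ j) Q'" "red P' \<noteq> 0 \<or> red Q' \<noteq> 0"
proof -
  have "\<exists>j P' Q'. P = smult (2 ^ j) P' \<and> Q = smult (2 ^ j) Q' \<and> (red P' \<noteq> 0 \<or> red Q' \<noteq> 0)"
    using assms
  proof (induction "nat (\<bar>lead_coeff P\<bar> + \<bar>lead_coeff Q\<bar>)" arbitrary: P Q rule: less_induct)
    case less
    show ?case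
    proof (cases "red P = 0 \<and> red Q = 0")
      case True
      then obtain p q where pq: "P = smult 2 p" "Q = smult 2 q"
        by (meson red_eq_0E)
      then have pq0: "p \<noteq> 0 \<or> q \<noteq> 0"
        using less.prems by auto
      then have "lead_coeff p \<noteq> 0 \<or> lead_coeff q \<noteq> 0"
        by simp
      then have "0 < \<bar>lead_coeff p\<bar> + \<bar>lead_coeff q\<bar>"
        by linarith
      then have "nat (\<bar>lead_coeff p\<bar> + \<bar>lead_coeff q\<bar>) < nat (\<bar>lead_coeff P\<bar> + \<bar>lead_coeff Q\<bar>)"
        by (simp add: pq abs_mult)
      from less.hyps[OF this pq0] show ?thesis
      proof (elim exE conjE)
        fix j P' Q'
        assume "p = smult (2 ^ j) P'" "q = smult (2 ^ j) Q'" and red: "red P' \<noteq> 0 \<or> red Q' \<noteq> 0"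
        then have "P = smult (2 ^ Suc j) P'" "Q = smult (2 ^ Suc j) Q'"
          by (simp_all add: pq)
        with red show ?thesis
          by (intro exI[of _ "Suc j"] exI[of _ P'] exI[of _ Q'] conjI)
      qed
    next
      case False
      then have "red P \<noteq> 0 \<or> red Q \<noteq> 0"
        by simp
      moreover have "P = smult (2 ^ 0) P" "Q = smult (2 ^ 0) Q"
        by simp_all
      ultimately show ?thesis
        by (intro exI[of _ 0] exI[of _ P] exI[of _ Q] conjI)
    qed
  qed
  then show thesis
    by (elim exE conjE) (rule that)
qed

text \<open>Over the integers this is p(z^2) and not the square of p; the name refers to what it
  becomes modulo 2.\<close>

abbreviation sqr :: "int poly \<Rightarrow> int poly" where "sqr p \<equiv> pcompose p (monom 1 2)"

lemma red_sqr: "red (sqr p) = (red p)\<^sup>2"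
  by (simp add: bit_poly_square of_int_hom.map_poly_pcompose)

lemma one_plus_power2_power:
  fixes x :: "bit poly"
  shows "1 + x ^ 2 ^ k = (1 + x) ^ 2 ^ k"
proof (induction k)
  case (Suc k)
  have "(1 + x) ^ 2 ^ Suc k = ((1 + x) ^ 2 ^ k)\<^sup>2"
    by (simp add: power_mult [symmetric] mult.commute)
  also have "\<dots> = 1 + (x ^ 2 ^ k)\<^sup>2 + 2 * x ^ 2 ^ k"
    by (simp add: Suc.IH [symmetric] power2_sum)
  finally show ?case
    by (simp add: power_mult [symmetric] mult.commute)
qed simp

section \<open>The functional equation over the integers\<close>

locale mahler_series =
  fixes \<alpha> \<beta> :: nat and e :: int
  assumes neq: "\<beta> \<noteq> \<alpha> + 1" and e: "e = 1 \<or> e = -1"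
begin

abbreviation "dn \<equiv> 1 + monom e (2 ^ \<beta>)"
abbreviation "nm \<equiv> monom (1::int) (2 ^ \<alpha>)"

lemma red_dn: "red dn = [:1, 1:] ^ 2 ^ \<beta>"
proof -
  have "red dn = 1 + monom (of_int e) (2 ^ \<beta>)"
    by (simp add: of_int_poly_hom.hom_add)
  also have "of_int e = (1::bit)"
    using e by auto
  also have "1 + monom (1::bit) (2 ^ \<beta>) = 1 + (monom 1 1) ^ 2 ^ \<beta>"
    by (simp add: monom_power)
  also have "\<dots> = (1 + monom 1 1) ^ 2 ^ \<beta>"
    by (rule one_plus_power2_power)
  also have "1 + monom 1 1 = [:1, 1::bit:]"
    by (simp add: monom_Suc one_pCons)
  finally show ?thesis .
qed

lemma red_nm: "red nm = monom 1 (2 ^ \<alpha>)"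
  by simp

text \<open>Modulo 2 a solution \<open>A = P / Q\<close> of \<open>A(z) = A(z\<^sup>2) + 2^k r(z)\<close> with \<open>k > 0\<close> satisfies \<open>A\<^sup>2 = A\<close>, so
  \<open>A / 2\<close> or \<open>(A - 1) / 2\<close> is a solution for \<open>k - 1\<close>.\<close>

lemma no_rational_solution_aux:
  assumes "red Q \<noteq> 0"
    and "P * sqr Q * dn = sqr P * Q * dn + smult (2 ^ k) (nm * Q * sqr Q)"
  shows False
  using assms
proof (induction k arbitrary: P)
  case 0
  define p q where "p = red P" and "q = red Q"
  have "red (P * sqr Q * dn) = red (sqr P * Q * dn + nm * Q * sqr Q)"
    using 0 by simp
  then have "p * q\<^sup>2 * red dn = p\<^sup>2 * q * red dn + red nm * q * q\<^sup>2"
    by (simp only: of_int_poly_hom.hom_mult of_int_poly_hom.hom_add red_sqr p_def q_def)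
  then have "q * (p\<^sup>2 * red dn + p * q * red dn + q\<^sup>2 * red nm) = 2 * (p * q\<^sup>2 * red dn)"
    by (simp only: algebra_simps power2_eq_square mult_2)
  then have "p\<^sup>2 * red dn + p * q * red dn + q\<^sup>2 * red nm = 0"
    using 0(1) by (simp add: q_def)
  then have "q = 0"
    using bit_norm_nonzero[OF neq, of p q] by (simp only: red_dn red_nm)
  then show False
    using 0(1) by (simp add: q_def)
next
  case (Suc k)
  define p q where "p = red P" and "q = red Q"
  have "red (P * sqr Q * dn) = red (sqr P * Q * dn + smult 2 (smult (2 ^ k) (nm * Q * sqr Q)))"
    using Suc.prems by simp
  also have "\<dots> = red (sqr P * Q * dn)"
    by (simp only: of_int_poly_hom.hom_add of_int_hom.map_poly_hom_smult) simp
  finally have "p * q\<^sup>2 * red dn = p\<^sup>2 * q * red dn"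
    by (simp only: of_int_poly_hom.hom_mult of_int_poly_hom.hom_add red_sqr p_def q_def)
  moreover have "(q * red dn) * (p * (p - q)) = p\<^sup>2 * q * red dn - p * q\<^sup>2 * red dn"
    by (simp only: algebra_simps power2_eq_square)
  ultimately have "(q * red dn) * (p * (p - q)) = 0"
    by (simp only: diff_self)
  moreover have "q * red dn \<noteq> 0"
    using Suc.prems(1) by (simp only: red_dn q_def) simp
  ultimately have "p = 0 \<or> p - q = 0"
    by (metis mult_eq_0_iff)
  then consider "red P = 0" | "red (P - Q) = 0"
    by (auto simp: p_def q_def of_int_poly_hom.hom_minus)
  then show False
  proof cases
    case 1
    then obtain P' where P': "P = smult 2 P'"
      by (rule red_eq_0E)
    have "smult 2 (P' * sqr Q * dn) = smult 2 (sqr P' * Q * dn + smult (2 ^ k) (nm * Q * sqr Q))"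
      using Suc.prems(2) by (simp add: P' pcompose_smult smult_add_right del: smult_eq_iff)
    then have "P' * sqr Q * dn = sqr P' * Q * dn + smult (2 ^ k) (nm * Q * sqr Q)"
      by (rule smult_left_cancel) simp
    then show False
      by (rule Suc.IH[OF Suc.prems(1)])
  next
    \<comment> \<open>Constants solve A(z) = A(z^2), so 1 may be subtracted from P / Q before
      halving.\<close>
    case 2
    then obtain P' where P': "P - Q = smult 2 P'"
      by (rule red_eq_0E)
    then have P: "P = Q + smult 2 P'"
      by (simp add: algebra_simps)
    have "smult 2 (P' * sqr Q * dn) = smult 2 (sqr P' * Q * dn + smult (2 ^ k) (nm * Q * sqr Q))"
      using Suc.prems(2) by (simp add: P pcompose_smult pcompose_add smult_add_right algebra_simps)
    then have "P' * sqr Q * dn = sqr P' * Q * dn + smult (2 ^ k) (nm * Q * sqr Q)"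
      by (rule smult_left_cancel) simp
    then show False
      by (rule Suc.IH[OF Suc.prems(1)])
  qed
qed

text \<open>Removing the factor 2^j from Q multiplies the solution P / Q by 2^j, and r along with
  it. This is the origin of the factor 2^k in the auxiliary form.\<close>

lemma no_rational_solution:
  assumes "Q \<noteq> 0" and eq: "P * sqr Q * dn = sqr P * Q * dn + nm * Q * sqr Q"
  shows False
proof -
  obtain j Q' where Q': "Q = smult (2 ^ j) Q'" "red Q' \<noteq> 0"
    using assms by (metis red_decomp_pair)
  have "smult (2 ^ j) (P * sqr Q' * dn)
      = smult (2 ^ j) (sqr P * Q' * dn + smult (2 ^ j) (nm * Q' * sqr Q'))"
    using eq by (simp add: Q' pcompose_smult smult_add_right)
  then have "P * sqr Q' * dn = sqr P * Q' * dn + smult (2 ^ j) (nm * Q' * sqr Q')"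
    by (rule smult_left_cancel) simp
  then show False
    by (rule no_rational_solution_aux[OF Q'(2)])
qed

text \<open>The conjugate of S modulo 2 is S + 1, and \<open>n\<close> is the norm (q t - p) (q (t +
  1) - p) cleared of its denominator by means of the equation for t. It is divisible by z^w and
  nonzero, so its degree bounds w. Since s is only a truncation of S, valid up to z^N, w is
  restricted to w \<le> N.\<close>

lemma vanishing_order_bound:
  assumes "degree P \<le> K" "degree Q \<le> K" "red P \<noteq> 0 \<or> red Q \<noteq> 0"
    and s: "monom 1 N dvd dn * sqr s - dn * s + nm"
    and w: "monom 1 w dvd Q * s - P" "w \<le> N"
  shows "w \<le> 2 * K + 2 ^ \<alpha> + 2 ^ \<beta>"
proof -
  define p q t x z where "p = red P" and "q = red Q" and "t = red s"
    and "x = [:1, 1::bit:] ^ 2 ^ \<beta>" and "z = monom (1::bit) (2 ^ \<alpha>)"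
  define n where "n = p\<^sup>2 * x + p * q * x + q\<^sup>2 * z"
  have x: "x = red dn" and z: "z = red nm"
    unfolding x_def z_def red_dn red_nm by simp_all
  have dvd_red: "monom 1 m dvd red u" if "monom 1 m dvd u" for m u
    using of_int_poly_hom.hom_dvd[OF that, where 'a = bit] by simp
  have "monom 1 w dvd dn * sqr s - dn * s + nm"
    using s monom_1_dvd_monom_1[OF w(2)] dvd_trans by blast
  then have "monom 1 w dvd x * t\<^sup>2 - x * t + z"
    using dvd_red by (metis (no_types, lifting) of_int_poly_hom.hom_mult of_int_poly_hom.hom_add
        of_int_poly_hom.hom_minus red_sqr x z t_def)
  moreover have "monom 1 w dvd q * t - p"
    using dvd_red[OF w(1)] by (simp add: of_int_poly_hom.hom_mult of_int_poly_hom.hom_minus p_def q_def t_def)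
  moreover have "n = (q * t - p) * (q * t + q - p) * x - q\<^sup>2 * (x * t\<^sup>2 - x * t + z)
      + 2 * (p * q * t * x + p * q * x + q\<^sup>2 * z - q\<^sup>2 * x * t)"
    by (simp add: n_def algebra_simps power2_eq_square)
  ultimately have "monom 1 w dvd n"
    by simp
  moreover have "n \<noteq> 0"
  proof
    assume n: "n = 0"
    then have "q = 0"
      unfolding n_def x_def z_def by (rule bit_norm_nonzero[OF neq])
    moreover from this have "p = 0"
      using n by (simp add: n_def x_def)
    ultimately show False
      using assms(3) by (simp add: p_def q_def)
  qed
  ultimately have "w \<le> degree n"
    using dvd_imp_degree_le[of "monom 1 w" n] by (simp add: degree_monom_eq)
  also have "degree n \<le> 2 * K + 2 ^ \<alpha> + 2 ^ \<beta>"
  proof -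
    have p: "degree p \<le> K" and q: "degree q \<le> K"
      using assms(1,2) degree_map_poly_le order_trans unfolding p_def q_def by blast+
    have x: "degree x \<le> 2 ^ \<beta>"
      unfolding x_def by (rule order_trans[OF degree_power_le]) simp
    have z: "degree z \<le> 2 ^ \<alpha>"
      by (simp add: z_def degree_monom_le)
    have "degree (p\<^sup>2 * x) \<le> 2 * K + 2 ^ \<beta>" "degree (p * q * x) \<le> 2 * K + 2 ^ \<beta>" "degree (q\<^sup>2 * z) \<le> 2 * K + 2 ^ \<alpha>"
      using p q x z degree_mult_le[of "p * p" x] degree_mult_le[of p p] degree_mult_le[of p q]
       degree_mult_le[of "p * q" x] degree_mult_le[of q q] degree_mult_le[of "q * q" z]
      by (simp_all add: power2_eq_square)
    then show ?thesis
      unfolding n_def by (intro degree_add_le) auto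
  qed
  finally show ?thesis .
qed

end

section \<open>A Liouville inequality for polynomials\<close>

text \<open>With fewer equations than unknowns, padding by zero rows gives a singular square matrix,
  and a singular integer matrix has a nonzero integer kernel vector. Unlike in Siegel's lemma the
  size of c is left open: the coefficients are fixed before the evaluation point tends to 0.\<close>

lemma int_linear_system:
  fixes a :: "nat \<Rightarrow> 'i \<Rightarrow> int"
  assumes "finite I" "N < card I"
  obtains c where "\<exists>i\<in>I. c i \<noteq> 0" "\<And>k. k < N \<Longrightarrow> (\<Sum>i\<in>I. c i * a k i) = 0"
proof -
  define n where "n = card I"
  obtain f where f: "bij_betw f {0..<n} I"
    using assms(1) ex_bij_betw_nat_finite n_def by blast
  define A where "A = Matrix.mat n n (\<lambda>(k, j). if k < N then a k (f j) else 0)"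
  have A: "A \<in> carrier_mat n n"
    by (simp add: A_def)
  have "transpose_mat A *\<^sub>v unit_vec n (n - 1) = 0\<^sub>v n"
  proof (rule eq_vecI)
    fix i
    assume i: "i < dim_vec (0\<^sub>v n :: int Matrix.vec)"
    then have "vec_index (transpose_mat A *\<^sub>v unit_vec n (n - 1)) i = vec_index (row (transpose_mat A) i) (n - 1)"
      using A by simp
    then show "vec_index (transpose_mat A *\<^sub>v unit_vec n (n - 1)) i = vec_index (0\<^sub>v n) i"
      using i assms(2) by (auto simp: A_def n_def)
  qed (simp add: A_def)
  moreover have "unit_vec n (n - 1) \<in> carrier_vec n" "unit_vec n (n - 1) \<noteq> (0\<^sub>v n :: int Matrix.vec)"
    using assms(2) by (auto simp: n_def)
  ultimately have "Determinant.det (transpose_mat A) = 0"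
    using det_0_iff_vec_prod_zero[of "transpose_mat A" n] A transpose_carrier_mat by blast
  then obtain v where v: "v \<in> carrier_vec n" "v \<noteq> 0\<^sub>v n" "A *\<^sub>v v = 0\<^sub>v n"
    using det_0_iff_vec_prod_zero[OF A] det_transpose[OF A] by auto
  define g where "g = the_inv_into {0..<n} f"
  define c where "c i = vec_index v (g i)" for i
  have gf: "g (f j) = j" if "j < n" for j
    using that f by (simp add: g_def bij_betw_def the_inv_into_f_f)
  obtain j where j: "j < n" "vec_index v j \<noteq> 0"
    using v by (metis carrier_vecD eq_vecI index_zero_vec(1) index_zero_vec(2))
  show thesis
  proof (rule that)
    show "\<exists>i\<in>I. c i \<noteq> 0"
      using j f gf by (intro bexI[of _ "f j"]) (auto simp: c_def bij_betw_def)
    fix k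
    assume k: "k < N"
    then have kn: "k < n"
      using assms(2) by (simp add: n_def)
    have "0 = vec_index (A *\<^sub>v v) k"
      using v kn by simp
    also have "\<dots> = (\<Sum>j\<in>{0..<n}. a k (f j) * vec_index v j)"
      using kn k v(1) A by (auto simp: scalar_prod_def A_def intro!: sum.cong)
    also have "\<dots> = (\<Sum>j\<in>{0..<n}. c (f j) * a k (f j))"
      by (intro sum.cong) (auto simp: c_def gf)
    also have "\<dots> = (\<Sum>i\<in>I. c i * a k i)"
      by (rule sum.reindex_bij_betw[OF f])
    finally show "(\<Sum>i\<in>I. c i * a k i) = 0"
      by simp
  qed
qed

lemma abs_det_le:
  fixes A :: "int mat" and B :: real
  assumes "A \<in> carrier_mat n n" "\<And>i j. i < n \<Longrightarrow> j < n \<Longrightarrow> \<bar>of_int (A $$ (i, j))\<bar> \<le> B"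
  shows "\<bar>of_int (Determinant.det A)\<bar> \<le> fact n * B ^ n"
proof -
  have "\<bar>real_of_int (Determinant.det A)\<bar>
      = \<bar>\<Sum>p | p permutes {0..<n}. of_int (signof p) * (\<Prod>i = 0..<n. of_int (A $$ (i, p i)))\<bar>"
    by (simp add: det_def'[OF assms(1)])
  also have "\<dots> \<le> (\<Sum>p | p permutes {0..<n}. \<bar>of_int (signof p) * (\<Prod>i = 0..<n. of_int (A $$ (i, p i)))\<bar>)"
    by (rule sum_abs)
  also have "\<dots> \<le> (\<Sum>p | p permutes {0..<n}. B ^ n)"
  proof (rule sum_mono)
    fix p :: "nat \<Rightarrow> nat"
    assume "p \<in> {p. p permutes {0..<n}}"
    then have p: "p i < n" if "i < n" for i
      using that by (auto dest: permutes_in_image[of p _ i])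
    have "\<bar>of_int (signof p) * (\<Prod>i = 0..<n. real_of_int (A $$ (i, p i)))\<bar>
        = (\<Prod>i = 0..<n. \<bar>real_of_int (A $$ (i, p i))\<bar>)"
      by (auto simp: abs_mult abs_prod sign_def)
    also have "\<dots> \<le> (\<Prod>i = 0..<n. B)"
      using assms(2) p by (intro prod_mono) auto
    finally show "\<bar>of_int (signof p) * (\<Prod>i = 0..<n. real_of_int (A $$ (i, p i)))\<bar> \<le> B ^ n"
      by simp
  qed
  also have "\<dots> = fact n * B ^ n"
    by (simp add: card_permutations)
  finally show ?thesis .
qed

text \<open>Every reduction of \<xi>^(deg P) by means of P costs one factor of the leading
  coefficient, which the power on the left pays for.\<close>

lemma algebraic_power_basis:
  fixes \<xi> :: real and P :: "int poly"
  assumes root: "poly (of_int_poly P) \<xi> = 0" and "degree P > 0"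
  shows "\<exists>c :: nat \<Rightarrow> int. of_int (lead_coeff P) ^ k * \<xi> ^ k = (\<Sum>j<degree P. of_int (c j) * \<xi> ^ j)"
proof (induction k)
  case 0
  have "(\<Sum>j<degree P. of_int (of_bool (j = 0)) * \<xi> ^ j) = (\<Sum>j<degree P. if j = 0 then 1 else 0)"
    by (intro sum.cong) auto
  then show ?case
    using assms(2) by (intro exI[of _ "\<lambda>j. of_bool (j = 0)"]) simp
next
  case (Suc k)
  define a where "a = lead_coeff P"
  obtain d where d: "degree P = Suc d"
    using assms(2) gr0_conv_Suc by auto
  obtain c :: "nat \<Rightarrow> int" where c: "of_int a ^ k * \<xi> ^ k = (\<Sum>j<Suc d. of_int (c j) * \<xi> ^ j)"
    using Suc a_def d by auto
  have "(\<Sum>j\<le>Suc d. of_int (coeff P j) * \<xi> ^ j) = 0"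
    using root by (simp add: poly_altdef d)
  then have top: "of_int a * \<xi> ^ Suc d = - (\<Sum>j<Suc d. of_int (coeff P j) * \<xi> ^ j)"
    unfolding sum.atMost_Suc lessThan_Suc_atMost a_def d by linarith
  define c' where "c' j = (if j = 0 then 0 else a * c (j - 1)) - c d * coeff P j" for j
  have "of_int a ^ Suc k * \<xi> ^ Suc k = of_int a * \<xi> * (of_int a ^ k * \<xi> ^ k)"
    by simp
  also have "\<dots> = (\<Sum>j<d. of_int (a * c j) * \<xi> ^ Suc j) + of_int (c d) * (of_int a * \<xi> ^ Suc d)"
    unfolding c by (simp add: sum_distrib_left distrib_left mult_ac)
  also have "(\<Sum>j<d. of_int (a * c j) * \<xi> ^ Suc j) = (\<Sum>j<Suc d. of_int (if j = 0 then 0 else a * c (j - 1)) * \<xi> ^ j)"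
    by (simp add: sum.lessThan_Suc_shift del: sum.lessThan_Suc)
  also have "\<dots> + of_int (c d) * (of_int a * \<xi> ^ Suc d) = (\<Sum>j<Suc d. of_int (c' j) * \<xi> ^ j)"
    unfolding top c'_def of_int_diff left_diff_distrib sum_subtractf of_int_mult mult.assoc sum_distrib_left[symmetric]
    by (simp del: sum.lessThan_Suc)
  finally show ?case
    unfolding a_def d by blast
qed

text \<open>Up to a power of the leading coefficient, multiplication by \<open>U(\<xi>)\<close> acts on \<open>1, \<xi>, \<dots>, \<xi>^(D-1)\<close> by an
  integer matrix \<open>A\<close>, whose determinant is nonzero by minimality of \<open>D\<close>. The first row of the adjugate
  identity expresses \<open>det A\<close> as \<open>U(\<xi>)\<close> times a bounded factor.\<close>

lemma algebraic_liouville: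
  fixes \<xi> :: real
  assumes "algebraic \<xi>"
  obtains D :: nat where "\<And>n. \<exists>\<kappa>>0. \<forall>U H. degree U \<le> n \<longrightarrow> (\<forall>i. \<bar>of_int (coeff U i)\<bar> \<le> H) \<longrightarrow>
    poly (of_int_poly U) \<xi> \<noteq> 0 \<longrightarrow> \<kappa> \<le> \<bar>poly (of_int_poly U) \<xi>\<bar> * H ^ D"
proof -
  define Dg where "Dg d \<longleftrightarrow> (\<exists>P :: int poly. P \<noteq> 0 \<and> degree P = d \<and> poly (of_int_poly P) \<xi> = 0)" for d
  define D where "D = (LEAST d. Dg d)"
  obtain P0 :: "int poly" where "P0 \<noteq> 0" "poly (of_int_poly P0) \<xi> = 0"
    using assms by (rule algebraicE')
  then have "Dg (degree P0)"
    by (auto simp: Dg_def)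
  then have "Dg D"
    unfolding D_def by (rule LeastI)
  then obtain P :: "int poly" where P: "P \<noteq> 0" "degree P = D" "poly (of_int_poly P) \<xi> = 0"
    by (auto simp: Dg_def)
  have minimal: "Q = 0" if "degree Q < D" "poly (of_int_poly Q) \<xi> = 0" for Q :: "int poly"
    using that not_less_Least[of "degree Q" Dg] by (auto simp: D_def Dg_def)
  have D: "D > 0"
  proof (rule ccontr)
    assume "\<not> D > 0"
    then obtain r where "P = [:r:]"
      using P(2) by (auto elim: degree_eq_zeroE)
    then show False
      using P by simp
  qed
  define a where "a = lead_coeff P"
  have a: "a \<noteq> 0"
    unfolding a_def using P(1) by (simp only: leading_coeff_0_iff) simp
  obtain E :: "nat \<Rightarrow> nat \<Rightarrow> int" where E: "of_int a ^ k * \<xi> ^ k = (\<Sum>j<D. of_int (E k j) * \<xi> ^ j)" for k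
    using algebraic_power_basis[OF P(3)] D unfolding P(2) a_def by metis
  \<comment> \<open>D - 1 is the size of the minors in the adjugate. It does not depend on n, so n
    can later be chosen in terms of this exponent.\<close>
  show thesis
  proof (rule that[of "D - 1"])
    fix n
    \<comment> \<open>All exponents t + i are at most n + D, so the common factor a^(n + D) makes
      every entry integral.\<close>
    define m where "m i j t = a ^ (n + D - (t + i)) * E (t + i) j" for i j t
    define C where "C = (\<Sum>i<D. \<Sum>j<D. \<Sum>t\<le>n. \<bar>real_of_int (m i j t)\<bar>)"
    define \<kappa> where "\<kappa> = 1 / ((\<Sum>k<D. fact (D - 1) * C ^ (D - 1) * \<bar>of_int a ^ (n + D) * \<xi> ^ k\<bar>) + 1)"
    have C: "C \<ge> 0"
      by (simp add: C_def sum_nonneg)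
    have den: "(\<Sum>k<D. fact (D - 1) * C ^ (D - 1) * \<bar>of_int a ^ (n + D) * \<xi> ^ k\<bar>) \<ge> 0"
      using C by (intro sum_nonneg) auto
    have "\<kappa> > 0"
      unfolding \<kappa>_def using den by (intro divide_pos_pos) linarith+
    moreover have "\<kappa> \<le> \<bar>poly (of_int_poly U) \<xi>\<bar> * H ^ (D - 1)"
      if U: "degree U \<le> n" "\<forall>i. \<bar>of_int (coeff U i)\<bar> \<le> H" "poly (of_int_poly U) \<xi> \<noteq> 0" for U H
    proof -
      define u where "u = poly (of_int_poly U) \<xi>"
      have H: "H \<ge> 0"
        using U(2) by (metis abs_ge_zero order_trans)
      define M where "M i j = (\<Sum>t\<le>n. coeff U t * m i j t)" for i j
      have M_bound: "\<bar>of_int (M i j)\<bar> \<le> H * C" if "i < D" "j < D" for i j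
      proof -
        have "\<bar>real_of_int (M i j)\<bar> \<le> (\<Sum>t\<le>n. \<bar>of_int (coeff U t) * of_int (m i j t)\<bar>)"
          by (simp add: M_def sum_abs)
        also have "\<dots> \<le> (\<Sum>t\<le>n. H * \<bar>of_int (m i j t)\<bar>)"
          using U(2) by (intro sum_mono) (auto simp: abs_mult intro!: mult_right_mono)
        also have "\<dots> = H * (\<Sum>t\<le>n. \<bar>of_int (m i j t)\<bar>)"
          by (simp add: sum_distrib_left)
        also have "(\<Sum>t\<le>n. \<bar>real_of_int (m i j t)\<bar>) \<le> (\<Sum>j<D. \<Sum>t\<le>n. \<bar>real_of_int (m i j t)\<bar>)"
          using that(2) by (intro member_le_sum) (auto intro: sum_nonneg)
        also have "\<dots> \<le> C"
          unfolding C_def using that(1)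
          by (intro member_le_sum[of i _ "\<lambda>i. \<Sum>j<D. \<Sum>t\<le>n. \<bar>real_of_int (m i j t)\<bar>"]) (auto intro!: sum_nonneg)
        finally show ?thesis
          using H by (simp add: mult_left_mono)
      qed
      have u_eq: "u = (\<Sum>t\<le>n. of_int (coeff U t) * \<xi> ^ t)"
        unfolding u_def poly_altdef using U(1)
        by (intro sum.mono_neutral_cong_left) (auto simp: coeff_eq_0)
      have M_eq: "(\<Sum>j<D. of_int (M i j) * \<xi> ^ j) = of_int a ^ (n + D) * \<xi> ^ i * u" if "i < D" for i
      proof -
        have "(\<Sum>j<D. of_int (M i j) * \<xi> ^ j) = (\<Sum>j<D. \<Sum>t\<le>n. of_int (coeff U t * m i j t) * \<xi> ^ j)"
          by (simp add: M_def sum_distrib_right)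
        also have "\<dots> = (\<Sum>t\<le>n. \<Sum>j<D. of_int (coeff U t * m i j t) * \<xi> ^ j)"
          by (rule sum.swap)
        also have "\<dots> = (\<Sum>t\<le>n. of_int (coeff U t) * of_int a ^ (n + D - (t + i)) * (\<Sum>j<D. of_int (E (t + i) j) * \<xi> ^ j))"
          by (simp add: m_def sum_distrib_left algebra_simps)
        also have "\<dots> = (\<Sum>t\<le>n. of_int (coeff U t) * of_int a ^ (n + D) * \<xi> ^ (t + i))"
        proof (rule sum.cong)
          fix t
          assume "t \<in> {..n}"
          then have "(n + D - (t + i)) + (t + i) = n + D"
            using that by auto
          then have "of_int a ^ (n + D) = of_int a ^ (n + D - (t + i)) * (of_int a ^ (t + i) :: real)"
            by (metis power_add)
          then show "of_int (coeff U t) * of_int a ^ (n + D - (t + i)) * (\<Sum>j<D. of_int (E (t + i) j) * \<xi> ^ j)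
            = of_int (coeff U t) * of_int a ^ (n + D) * \<xi> ^ (t + i)"
            by (simp add: E[symmetric])
        qed simp
        also have "\<dots> = of_int a ^ (n + D) * \<xi> ^ i * u"
          by (simp add: u_eq sum_distrib_left power_add algebra_simps)
        finally show ?thesis .
      qed
      define A where "A = Matrix.mat D D (\<lambda>(i, j). M i j)"
      have A: "A \<in> carrier_mat D D"
        by (simp add: A_def)
      have "Determinant.det A \<noteq> 0"
      proof
        assume "Determinant.det A = 0"
        then have "Determinant.det (transpose_mat A) = 0"
          using det_transpose[OF A] by simp
        moreover have At: "transpose_mat A \<in> carrier_mat D D"
          using A by simp
        ultimately obtain v where v: "v \<in> carrier_vec D" "v \<noteq> 0\<^sub>v D" "transpose_mat A *\<^sub>v v = 0\<^sub>v D"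
          using det_0_iff_vec_prod_zero by blast
        have ker: "(\<Sum>i<D. M i j * vec_index v i) = 0" if "j < D" for j
        proof -
          have "0 = vec_index (transpose_mat A *\<^sub>v v) j"
            using v that by simp
          also have "\<dots> = (\<Sum>i<D. M i j * vec_index v i)"
            using that v(1) A by (auto simp: scalar_prod_def A_def atLeast0LessThan intro!: sum.cong)
          finally show ?thesis by simp
        qed
        define V where "V = (\<Sum>i<D. monom (vec_index v i) i)"
        have coeff_V: "coeff V i = (if i < D then vec_index v i else 0)" for i
          by (simp add: V_def coeff_sum)
        have "of_int a ^ (n + D) * u * poly (of_int_poly V) \<xi> = (\<Sum>i<D. of_int (vec_index v i) * (of_int a ^ (n + D) * \<xi> ^ i * u))"
          by (simp add: V_def of_int_poly_hom.hom_sum poly_sum poly_monom sum_distrib_left algebra_simps)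
        also have "\<dots> = (\<Sum>i<D. \<Sum>j<D. of_int (vec_index v i) * (of_int (M i j) * \<xi> ^ j))"
          by (simp add: M_eq [symmetric] sum_distrib_left)
        also have "\<dots> = (\<Sum>j<D. \<Sum>i<D. of_int (vec_index v i) * (of_int (M i j) * \<xi> ^ j))"
          by (rule sum.swap)
        also have "\<dots> = (\<Sum>j<D. of_int (\<Sum>i<D. M i j * vec_index v i) * \<xi> ^ j)"
          by (simp add: sum_distrib_left mult_ac)
        also have "\<dots> = 0"
          using ker by simp
        finally have "poly (of_int_poly V) \<xi> = 0"
          using a U(3) by (simp add: u_def)
        moreover have "degree V < D"
          using D coeff_V by (intro degree_lessI) auto
        ultimately have "V = 0"
          by (intro minimal)
        then have "v = 0\<^sub>v D"
          using v(1) coeff_V by - (rule eq_vecI, metis carrier_vecD coeff_0 index_zero_vec(1) index_zero_vec(2), simp)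
        then show False
          using v(2) by simp
      qed
      then have "1 \<le> \<bar>real_of_int (Determinant.det A)\<bar>"
        by linarith
      define b where "b k = adj_mat A $$ (0, k)" for k
      have b_bound: "\<bar>of_int (b k)\<bar> \<le> fact (D - 1) * (H * C) ^ (D - 1)" if "k < D" for k
      proof -
        have "b k = cofactor A k 0"
          using that D A by (simp add: b_def adj_mat_def)
        then have "\<bar>real_of_int (b k)\<bar> = \<bar>of_int (Determinant.det (mat_delete A k 0))\<bar>"
          by (simp add: cofactor_def abs_mult)
        also have "\<dots> \<le> fact (D - 1) * (H * C) ^ (D - 1)"
        proof (rule abs_det_le)
          fix i j
          assume "i < D - 1" "j < D - 1"
          then show "\<bar>real_of_int (mat_delete A k 0 $$ (i, j))\<bar> \<le> H * C"
            using A M_bound by (simp add: mat_delete_def A_def)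
        qed (simp add: mat_delete_def A_def)
        finally show ?thesis .
      qed
      have adj: "(\<Sum>k<D. b k * M k j) = (if j = 0 then Determinant.det A else 0)" if "j < D" for j
      proof -
        have "(adj_mat A * A) $$ (0, j) = (\<Sum>k<D. b k * M k j)"
          using that D A adj_mat(1)[OF A] by (auto simp: scalar_prod_def A_def b_def atLeast0LessThan intro!: sum.cong)
        then show ?thesis
          using that D by (cases "j = 0") (simp_all add: adj_mat(3)[OF A])
      qed
      have "real_of_int (Determinant.det A) = (\<Sum>j<D. of_int (\<Sum>k<D. b k * M k j) * \<xi> ^ j)"
      proof -
        have "(\<Sum>j<D. of_int (\<Sum>k<D. b k * M k j) * \<xi> ^ j) = (\<Sum>j<D. if j = 0 then real_of_int (Determinant.det A) else 0)"
          using adj by (intro sum.cong) auto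
        then show ?thesis
          using D by simp
      qed
      also have "\<dots> = (\<Sum>j<D. \<Sum>k<D. of_int (b k) * (of_int (M k j) * \<xi> ^ j))"
        by (simp add: sum_distrib_left mult_ac)
      also have "\<dots> = (\<Sum>k<D. \<Sum>j<D. of_int (b k) * (of_int (M k j) * \<xi> ^ j))"
        by (rule sum.swap)
      also have "\<dots> = (\<Sum>k<D. of_int (b k) * (of_int a ^ (n + D) * \<xi> ^ k * u))"
        by (simp add: M_eq [symmetric] sum_distrib_left)
      finally have "1 \<le> \<bar>\<Sum>k<D. of_int (b k) * (of_int a ^ (n + D) * \<xi> ^ k * u)\<bar>"
        using \<open>1 \<le> \<bar>real_of_int (Determinant.det A)\<bar>\<close> by simp
      also have "\<dots> \<le> (\<Sum>k<D. \<bar>of_int (b k) * (of_int a ^ (n + D) * \<xi> ^ k * u)\<bar>)"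
        by (rule sum_abs)
      also have "\<dots> \<le> (\<Sum>k<D. (fact (D - 1) * (H * C) ^ (D - 1)) * \<bar>of_int a ^ (n + D) * \<xi> ^ k * u\<bar>)"
        using b_bound by (intro sum_mono) (simp only: abs_mult, intro mult_right_mono, auto)
      also have "\<dots> = \<bar>u\<bar> * H ^ (D - 1) * (\<Sum>k<D. fact (D - 1) * C ^ (D - 1) * \<bar>of_int a ^ (n + D) * \<xi> ^ k\<bar>)"
        by (simp add: sum_distrib_left abs_mult power_mult_distrib algebra_simps)
      also have "\<dots> \<le> \<bar>u\<bar> * H ^ (D - 1) * ((\<Sum>k<D. fact (D - 1) * C ^ (D - 1) * \<bar>of_int a ^ (n + D) * \<xi> ^ k\<bar>) + 1)"
        using H by (intro mult_left_mono) auto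
      finally show ?thesis
        unfolding \<kappa>_def u_def[symmetric] using den by (simp add: divide_le_eq)
    qed
    ultimately show "\<exists>\<kappa>>0. \<forall>U H. degree U \<le> n \<longrightarrow> (\<forall>i. \<bar>of_int (coeff U i)\<bar> \<le> H) \<longrightarrow>
        poly (of_int_poly U) \<xi> \<noteq> 0 \<longrightarrow> \<kappa> \<le> \<bar>poly (of_int_poly U) \<xi>\<bar> * H ^ (D - 1)"
      by blast
  qed
qed

section \<open>Polynomial expansions at 0\<close>

abbreviation ev :: "int poly \<Rightarrow> real \<Rightarrow> real" where "ev p x \<equiv> poly (of_int_poly p) x"

lemmas ev_simps = of_int_poly_hom.hom_add of_int_poly_hom.hom_minus of_int_poly_hom.hom_uminus
  of_int_poly_hom.hom_mult of_int_poly_hom.hom_power of_int_poly_hom.hom_sum of_int_hom.map_poly_pcompose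
  of_int_hom.map_poly_hom_smult of_int_hom.map_poly_pCons_hom poly_monom poly_pcompose poly_sum

lemma eventually_small: "\<forall>\<^sub>F x in at_right (0::real). 0 < x \<and> x \<le> 1 / 2"
  using eventually_at_right_real[of 0 "1 / 2"] by (auto elim: eventually_mono)

lemma bigo_power_mono: "M \<le> N \<Longrightarrow> f \<in> O[at_right 0](\<lambda>x::real. x ^ N) \<Longrightarrow> f \<in> O[at_right 0](\<lambda>x. x ^ M)"
  by (erule landau_o.big_trans, intro landau_o.bigI[of 1] eventually_mono[OF eventually_small])
    (auto intro: power_decreasing)

lemma bigo_mult_bounded:
  fixes f g h :: "real \<Rightarrow> real"
  shows "f \<in> O[F](h) \<Longrightarrow> g \<in> O[F](\<lambda>_. 1) \<Longrightarrow> (\<lambda>x. f x * g x) \<in> O[F](h)"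
  using landau_o.big.mult[of f F h g "\<lambda>_. 1"] by simp

lemma bigo_square:
  assumes "f \<in> O[at_right 0](\<lambda>x::real. x ^ N)"
  shows "(\<lambda>x. f (x\<^sup>2)) \<in> O[at_right 0](\<lambda>x::real. x ^ N)"
proof (rule bigo_power_mono)
  have "filterlim (\<lambda>x::real. x\<^sup>2) (at_right 0) (at_right 0)"
    by real_asymp
  from landau_o.big.compose[OF assms this] show "(\<lambda>x. f (x\<^sup>2)) \<in> O[at_right 0](\<lambda>x::real. x ^ (2 * N))"
    by (simp add: power_mult)
qed simp

lemma ev_bounded: "ev p \<in> O[at_right 0](\<lambda>_. 1)"
proof (rule bigoI_tendsto)
  show "((\<lambda>x. ev p x / 1) \<longlongrightarrow> ev p 0) (at_right 0)"
    by (auto intro!: tendsto_eq_intros)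
qed simp

text \<open>After division by x^w the error is O(x^(N - w)) and tends to 0, so |g x| / x^w tends to
  h > 0; the constants h / 2 and 2 h merely enclose this limit.\<close>

lemma leading_term:
  assumes p: "p = monom 1 w * p'" "coeff p' 0 \<noteq> 0" and "w < N"
    and g: "(\<lambda>x. g x - ev p x) \<in> O[at_right 0](\<lambda>x. x ^ N)"
  defines "h \<equiv> \<bar>real_of_int (coeff p' 0)\<bar>"
  shows "\<forall>\<^sub>F x in at_right 0. h / 2 * x ^ w \<le> \<bar>g x\<bar> \<and> \<bar>g x\<bar> \<le> 2 * h * x ^ w"
proof -
  obtain C where C: "\<forall>\<^sub>F x in at_right 0. \<bar>g x - ev p x\<bar> \<le> C * \<bar>x ^ N\<bar>"
    using g by (auto elim!: landau_o.bigE)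
  have small: "((\<lambda>x. (g x - ev p x) / x ^ w) \<longlongrightarrow> 0) (at_right 0)"
  proof (rule Lim_null_comparison)
    show "\<forall>\<^sub>F x in at_right 0. norm ((g x - ev p x) / x ^ w) \<le> C * x ^ (N - w)"
      using C eventually_small
    proof eventually_elim
      case (elim x)
      have "x ^ N = x ^ (N - w) * x ^ w"
        using \<open>w < N\<close> by (simp flip: power_add)
      then show ?case
        using elim by (simp add: abs_divide divide_le_eq)
    qed
    show "((\<lambda>x. C * x ^ (N - w)) \<longlongrightarrow> 0) (at_right 0)"
      using \<open>w < N\<close> by (auto intro!: tendsto_eq_intros)
  qed
  have "((\<lambda>x. (g x - ev p x) / x ^ w + ev p' x) \<longlongrightarrow> 0 + ev p' 0) (at_right 0)"
    by (intro tendsto_add small) (auto intro!: tendsto_eq_intros)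
  then have "((\<lambda>x. \<bar>(g x - ev p x) / x ^ w + ev p' x\<bar>) \<longlongrightarrow> \<bar>0 + ev p' 0\<bar>) (at_right 0)"
    by (rule tendsto_rabs)
  moreover have "\<bar>0 + ev p' 0\<bar> = h"
    by (simp add: h_def poly_0_coeff_0)
  ultimately have lim: "((\<lambda>x. \<bar>(g x - ev p x) / x ^ w + ev p' x\<bar>) \<longlongrightarrow> h) (at_right 0)"
    by simp
  have "h > 0"
    using p(2) by (simp add: h_def)
  then have "h / 2 < h" "h < 2 * h"
    by simp_all
  from order_tendstoD(1)[OF lim this(1)] order_tendstoD(2)[OF lim this(2)]
    eventually_small
  show ?thesis
  proof eventually_elim
    case (elim x)
    have "(g x - ev p x) / x ^ w + ev p' x = g x / x ^ w"
      using elim by (simp add: p(1) ev_simps field_simps)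
    then show ?case
      using elim by (simp add: abs_divide field_simps)
  qed
qed

lemma poly_eq_monom_mult:
  assumes "(p :: int poly) \<noteq> 0"
  obtains w p' where "p = monom 1 w * p'" "coeff p' 0 \<noteq> 0"
proof -
  obtain q where q: "p = [:-0, 1:] ^ order 0 p * q" "\<not> [:-0, 1:] dvd q"
    using order_decomp[OF assms] by blast
  show thesis
  proof (rule that)
    show "p = monom 1 (order 0 p) * q"
      using q(1) by (simp add: monom_altdef)
    show "coeff q 0 \<noteq> 0"
      using q(2) poly_eq_0_iff_dvd[of q 0] by (simp add: poly_0_coeff_0)
  qed
qed

text \<open>The dictionary between congruences modulo z^N and growth at 0. For the harder direction,
  \<open>leading_term\<close> with the zero function as g excludes an exact order w < N.\<close>

lemma ev_bigo_iff: "ev p \<in> O[at_right 0](\<lambda>x. x ^ N) \<longleftrightarrow> monom 1 N dvd p"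
proof
  assume "monom 1 N dvd p"
  then obtain q where q: "p = monom 1 N * q"
    by blast
  have "(\<lambda>x. x ^ N * ev q x) \<in> O[at_right 0](\<lambda>x. x ^ N)"
    by (intro bigo_mult_bounded ev_bounded) simp
  then show "ev p \<in> O[at_right 0](\<lambda>x. x ^ N)"
    by (simp add: q ev_simps)
next
  assume O: "ev p \<in> O[at_right 0](\<lambda>x. x ^ N)"
  show "monom 1 N dvd p"
  proof (cases "p = 0")
    case False
    then obtain w p' where p: "p = monom 1 w * p'" "coeff p' 0 \<noteq> 0"
      by (rule poly_eq_monom_mult)
    have "N \<le> w"
    proof (rule ccontr)
      assume "\<not> N \<le> w"
      then have "\<forall>\<^sub>F x in at_right 0. \<bar>real_of_int (coeff p' 0)\<bar> / 2 * x ^ w \<le> \<bar>0::real\<bar>"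
        using leading_term[OF p, of N "\<lambda>_. 0"] O by (auto elim: eventually_mono)
      from eventually_conj[OF this eventually_small]
      have "\<forall>\<^sub>F x::real in at_right 0. False"
        by eventually_elim (use p(2) in \<open>auto simp: mult_le_0_iff dest: leD\<close>)
      then show False
        by simp
    qed
    then show ?thesis
      using p(1) by (metis dvd_mult2 monom_1_dvd_monom_1)
  qed simp
qed

text \<open>The coefficients of T are polynomials in x, and its outer variable is y, the place of
  S(x).\<close>

definition eval2 :: "int poly poly \<Rightarrow> real \<Rightarrow> real \<Rightarrow> real" where
  "eval2 T x y = poly (map_poly (\<lambda>p. ev p x) T) y"

interpretation ev_hom: comm_ring_hom "\<lambda>p. ev p x" for x
  by unfold_locales (simp_all add: ev_simps)

interpretation ev_poly_hom: map_poly_comm_ring_hom "\<lambda>p. ev p x" for x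
  by unfold_locales

lemma eval2_simps:
  "eval2 0 x y = 0" "eval2 [:p:] x y = ev p x"
  "eval2 (T + U) x y = eval2 T x y + eval2 U x y" "eval2 (T - U) x y = eval2 T x y - eval2 U x y"
  "eval2 (T * U) x y = eval2 T x y * eval2 U x y" "eval2 (smult p T) x y = ev p x * eval2 T x y"
  "eval2 (pCons p T) x y = ev p x + y * eval2 T x y" "eval2 (T ^ n) x y = eval2 T x y ^ n"
  "eval2 (monom p n) x y = ev p x * y ^ n"
  "eval2 (sum f A) x y = (\<Sum>i\<in>A. eval2 (f i) x y)"
  by (simp_all add: eval2_def ev_hom.map_poly_pCons_hom ev_hom.map_poly_hom_add ev_hom.map_poly_hom_smult
      ev_poly_hom.hom_minus ev_poly_hom.hom_mult ev_poly_hom.hom_power ev_poly_hom.hom_sum poly_sum poly_monom)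

lemma eval2_altdef: "eval2 T x y = (\<Sum>j\<le>degree T. ev (coeff T j) x * y ^ j)"
proof -
  have "eval2 T x y = eval2 (\<Sum>j\<le>degree T. monom (coeff T j) j) x y"
    by (simp add: poly_as_sum_of_monoms)
  then show ?thesis
    by (simp add: eval2_simps)
qed

lemma eval2_expansion:
  assumes f: "(\<lambda>x. f x - ev s x) \<in> O[at_right 0](\<lambda>x. x ^ N)"
  shows "(\<lambda>x. eval2 T x (f x) - ev (poly T s) x) \<in> O[at_right 0](\<lambda>x. x ^ N)"
proof (induction T)
  case (pCons a T)
  have "(\<lambda>x. f x - ev s x) \<in> O[at_right 0](\<lambda>_. 1)"
    using bigo_power_mono[OF _ f, of 0] by simp
  from sum_in_bigo(1)[OF this ev_bounded[of s]] have "f \<in> O[at_right 0](\<lambda>_. 1)"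
    by simp
  then have "(\<lambda>x. (eval2 T x (f x) - ev (poly T s) x) * f x + (f x - ev s x) * ev (poly T s) x) \<in> O[at_right 0](\<lambda>x. x ^ N)"
    by (intro sum_in_bigo bigo_mult_bounded pCons.IH f ev_bounded)
  then show ?case
    by (simp add: eval2_simps ev_simps algebra_simps)
qed (simp add: eval2_simps)

section \<open>The Mahler function\<close>

lemma rational_expansion:
  fixes e :: int
  assumes e: "e = 1 \<or> e = -1" and "l > 0"
  shows "\<exists>s. (\<lambda>x. x ^ k / (1 + of_int e * x ^ l) - ev s x) \<in> O[at_right 0](\<lambda>x. x ^ N)"
proof (intro exI)
  define s where "s = monom 1 k * (\<Sum>i<N. (monom (-e) l) ^ i)"
  show "(\<lambda>x. x ^ k / (1 + of_int e * x ^ l) - ev s x) \<in> O[at_right 0](\<lambda>x. x ^ N)"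
  proof (rule landau_o.bigI[of 2])
    show "\<forall>\<^sub>F x in at_right 0. norm (x ^ k / (1 + of_int e * x ^ l) - ev s x) \<le> 2 * norm (x ^ N)"
      using eventually_small
    proof eventually_elim
      case (elim x)
      define q where "q = - (of_int e * x ^ l)"
      have "x ^ l \<le> x ^ 1"
        using elim \<open>l > 0\<close> by (intro power_decreasing) auto
      then have xl: "x ^ l \<le> 1 / 2"
        using elim by simp
      then have d: "1 + of_int e * x ^ l \<ge> 1 / 2"
        using e elim by auto
      have evs: "ev s x = x ^ k * (\<Sum>i<N. q ^ i)"
        by (simp add: s_def ev_simps q_def)
      have "(1 - q) * (\<Sum>i<N. q ^ i) = 1 - q ^ N"
        by (simp add: one_diff_power_eq)
      moreover have "x ^ k / (1 - q) - x ^ k * (\<Sum>i<N. q ^ i) = x ^ k * (1 - (1 - q) * (\<Sum>i<N. q ^ i)) / (1 - q)"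
        using d by (simp add: q_def diff_divide_distrib right_diff_distrib)
      ultimately have "x ^ k / (1 - q) - x ^ k * (\<Sum>i<N. q ^ i) = x ^ k * q ^ N / (1 - q)"
        by simp
      then have "\<bar>x ^ k / (1 + of_int e * x ^ l) - ev s x\<bar> = x ^ k * \<bar>q\<bar> ^ N / (1 + of_int e * x ^ l)"
        using d elim by (simp add: evs q_def abs_mult power_abs)
      also have "\<dots> \<le> 1 * x ^ N / (1 / 2)"
      proof (intro frac_le mult_mono)
        have "\<bar>q\<bar> = x ^ l"
          using e elim by (auto simp: q_def)
        then have "\<bar>q\<bar> \<le> x"
          using \<open>x ^ l \<le> x ^ 1\<close> by simp
        then show "\<bar>q\<bar> ^ N \<le> x ^ N"
          by (intro power_mono) auto
      qed (use d elim in \<open>auto intro: power_le_one\<close>)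
      finally show ?case
        using elim by simp
    qed
  qed simp
qed

context mahler_series
begin

definition r :: "real \<Rightarrow> real" where
  "r x = x ^ 2 ^ \<alpha> / (1 + of_int e * x ^ 2 ^ \<beta>)"

definition S :: "real \<Rightarrow> real" where
  "S x = (\<Sum>n. r (x ^ 2 ^ n))"

text \<open>The interval 0 < x \<le> 1/2 is stable under squaring, contains every 1/b, and keeps the
  denominator away from 0 for both signs of e.\<close>

lemma r_denominator:
  assumes "0 < x" "x \<le> 1 / 2"
  shows "1 + of_int e * x ^ 2 ^ \<beta> \<ge> (1 / 2 :: real)"
proof -
  have "x ^ 2 ^ \<beta> \<le> x ^ 1"
    using assms by (intro power_decreasing) auto
  then show ?thesis
    using assms e by auto
qed

lemma power_two_power_le:
  fixes x :: real
  assumes "0 < x" "x \<le> 1 / 2"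
  shows "x ^ 2 ^ n \<le> x ^ Suc n" "0 < x ^ 2 ^ n" "x ^ 2 ^ n \<le> 1 / 2"
proof -
  have "Suc n \<le> 2 ^ n"
    by (simp add: Suc_leI)
  then show "x ^ 2 ^ n \<le> x ^ Suc n"
    using assms by (intro power_decreasing) auto
  show "0 < x ^ 2 ^ n"
    using assms by simp
  have "x ^ 2 ^ n \<le> x ^ 1"
    using assms by (intro power_decreasing) auto
  then show "x ^ 2 ^ n \<le> 1 / 2"
    using assms by simp
qed

lemma r_bound:
  assumes "0 < x" "x \<le> 1 / 2"
  shows "\<bar>r x\<bar> \<le> 2 * x"
proof -
  have "x ^ 2 ^ \<alpha> \<le> x ^ 1"
    using assms by (intro power_decreasing) auto
  then have "x ^ 2 ^ \<alpha> / (1 + of_int e * x ^ 2 ^ \<beta>) \<le> x / (1 / 2)"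
    using assms r_denominator[OF assms] by (intro frac_le) auto
  moreover have "0 \<le> x ^ 2 ^ \<alpha> / (1 + of_int e * x ^ 2 ^ \<beta>)"
    using assms r_denominator[OF assms] by (intro divide_nonneg_nonneg) auto
  ultimately show ?thesis
    by (simp only: r_def abs_of_nonneg) simp
qed

lemma r_geometric_bound:
  assumes "0 < x" "x \<le> 1 / 2"
  shows "\<bar>r (x ^ 2 ^ n)\<bar> \<le> 2 * x * x ^ n"
  using r_bound[OF power_two_power_le(2,3)[OF assms], of n] power_two_power_le(1)[OF assms, of n]
  by simp

lemma S_summable:
  assumes "0 < x" "x \<le> 1 / 2"
  shows "summable (\<lambda>n. r (x ^ 2 ^ n))"
proof (rule summable_comparison_test'[where g = "\<lambda>n. 2 * x * x ^ n" and N = 0])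
  show "summable (\<lambda>n. 2 * x * x ^ n)"
    using assms by (intro summable_mult summable_geometric) auto
qed (use r_geometric_bound[OF assms] in simp)

lemma S_bound:
  assumes "0 < x" "x \<le> 1 / 2"
  shows "\<bar>S x\<bar> \<le> 4 * x"
proof -
  have g: "(\<lambda>n. 2 * x * x ^ n) sums (2 * x * (1 / (1 - x)))"
    using assms by (intro sums_mult geometric_sums) auto
  have "norm (S x) \<le> (\<Sum>n. 2 * x * x ^ n)"
    unfolding S_def using r_geometric_bound[OF assms]
    by (intro norm_suminf_le sums_summable[OF g]) auto
  also have "\<dots> = 2 * x * (1 / (1 - x))"
    using g by (simp add: sums_iff)
  also have "\<dots> \<le> 2 * x * 2"
    using assms by (intro mult_left_mono) (auto simp: field_simps)
  finally show ?thesis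
    by simp
qed

lemma S_iterate:
  assumes "0 < x" "x \<le> 1 / 2"
  shows "S x = (\<Sum>n<m. r (x ^ 2 ^ n)) + S (x ^ 2 ^ m)"
proof -
  have "r (x ^ 2 ^ (n + m)) = r ((x ^ 2 ^ m) ^ 2 ^ n)" for n
    by (simp add: power_add power_mult[symmetric] mult.commute)
  then show ?thesis
    unfolding S_def using suminf_split_initial_segment[OF S_summable[OF assms], of m]
    by simp
qed

lemma S_functional:
  assumes "0 < x" "x \<le> 1 / 2"
  shows "S x = r x + S (x\<^sup>2)"
  using S_iterate[OF assms, of 1] by (simp add: numeral_2_eq_2)

text \<open>The first N summands are rational with denominators of constant term 1, hence have
  integral expansions. The rest is S(x^(2^N)), which is O(x^(2^N)) and so O(x^N).\<close>

lemma S_expansion: "\<exists>s. (\<lambda>x. S x - ev s x) \<in> O[at_right 0](\<lambda>x. x ^ N)"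
proof -
  have "\<exists>s. (\<lambda>x. (\<Sum>n<m. r (x ^ 2 ^ n)) - ev s x) \<in> O[at_right 0](\<lambda>x. x ^ N)" for m
  proof (induction m)
    case 0
    show ?case
      by (intro exI[of _ 0]) simp
  next
    case (Suc m)
    then obtain s where s: "(\<lambda>x. (\<Sum>n<m. r (x ^ 2 ^ n)) - ev s x) \<in> O[at_right 0](\<lambda>x. x ^ N)"
      by blast
    obtain t where t: "(\<lambda>x. x ^ (2 ^ m * 2 ^ \<alpha>) / (1 + of_int e * x ^ (2 ^ m * 2 ^ \<beta>)) - ev t x) \<in> O[at_right 0](\<lambda>x. x ^ N)"
      using rational_expansion[OF e] by fastforce
    have "x ^ (2 ^ m * 2 ^ \<alpha>) / (1 + of_int e * x ^ (2 ^ m * 2 ^ \<beta>)) = r (x ^ 2 ^ m)" for x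
      by (simp add: r_def power_mult)
    from sum_in_bigo(1)[OF s t[unfolded this]] show ?case
      by (intro exI[of _ "s + t"]) (simp add: ev_simps algebra_simps)
  qed
  then obtain s where s: "(\<lambda>x. (\<Sum>n<N. r (x ^ 2 ^ n)) - ev s x) \<in> O[at_right 0](\<lambda>x. x ^ N)"
    by blast
  have tail: "(\<lambda>x. S (x ^ 2 ^ N)) \<in> O[at_right 0](\<lambda>x. x ^ N)"
  proof (rule landau_o.bigI[of 4])
    show "\<forall>\<^sub>F x in at_right 0. norm (S (x ^ 2 ^ N)) \<le> 4 * norm (x ^ N)"
      using eventually_small
    proof eventually_elim
      case (elim x)
      have "\<bar>S (x ^ 2 ^ N)\<bar> \<le> 4 * x ^ 2 ^ N"
        using elim by (intro S_bound power_two_power_le) auto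
      also have "x ^ 2 ^ N \<le> x ^ N"
        using elim less_imp_le[OF less_exp, of N] by (intro power_decreasing) auto
      finally show ?case
        using elim by simp
    qed
  qed simp
  have "(\<lambda>x. S x - ev s x) \<in> O[at_right 0](\<lambda>x. x ^ N) \<longleftrightarrow>
    (\<lambda>x. ((\<Sum>n<N. r (x ^ 2 ^ n)) - ev s x) + S (x ^ 2 ^ N)) \<in> O[at_right 0](\<lambda>x. x ^ N)"
    by (rule landau_o.big.in_cong, rule eventually_mono[OF eventually_small])
      (use S_iterate[of _ N] in auto)
  then show ?thesis
    using sum_in_bigo(1)[OF s tail] by blast
qed

lemma S_expansion_functional:
  assumes s: "(\<lambda>x. S x - ev s x) \<in> O[at_right 0](\<lambda>x. x ^ N)"
  shows "monom 1 N dvd dn * sqr s - dn * s + nm"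
  unfolding ev_bigo_iff[symmetric]
proof -
  have "(\<lambda>x. ((S x - ev s x) - (S (x\<^sup>2) - ev s (x\<^sup>2))) * ev (dn) x) \<in> O[at_right 0](\<lambda>x. x ^ N)"
    by (intro bigo_mult_bounded sum_in_bigo s bigo_square[OF s] ev_bounded)
  also have "?this \<longleftrightarrow> ev (dn * sqr s - dn * s + nm) \<in> O[at_right 0](\<lambda>x. x ^ N)"
  proof (rule landau_o.big.in_cong, rule eventually_mono[OF eventually_small])
    fix x :: real
    assume x: "0 < x \<and> x \<le> 1 / 2"
    have "S x - S (x\<^sup>2) = r x"
      using S_functional x by simp
    moreover have "r x * ev (dn) x = ev (nm) x"
      using r_denominator x by (fastforce simp: r_def ev_simps)
    ultimately have "(S x - S (x\<^sup>2)) * ev (dn) x = ev (nm) x"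
      by simp
    then show "((S x - ev s x) - (S (x\<^sup>2) - ev s (x\<^sup>2))) * ev (dn) x
        = ev (dn * sqr s - dn * s + nm) x"
      by (simp add: ev_simps algebra_simps)
  qed
  finally show "ev (dn * sqr s - dn * s + nm) \<in> O[at_right 0](\<lambda>x. x ^ N)" .
qed


text \<open>This encodes the identity T(z, S(z)) = 0 of power series.\<close>

definition vanishing :: "int poly poly \<Rightarrow> bool" where
  "vanishing T \<longleftrightarrow> (\<forall>N. (\<lambda>x. eval2 T x (S x)) \<in> O[at_right 0](\<lambda>x. x ^ N))"

lemma vanishing_const:
  assumes "vanishing [:p:]"
  shows "p = 0"
proof (rule ccontr)
  assume "p \<noteq> 0"
  have "monom 1 (Suc (degree p)) dvd p"
    using assms unfolding vanishing_def eval2_simps mult_zero_right add_0_right ev_bigo_iff by blast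
  with \<open>p \<noteq> 0\<close> have "Suc (degree p) \<le> degree p"
    by (metis degree_monom_eq dvd_imp_degree_le zero_neq_one)
  then show False
    by simp
qed

text \<open>A nonzero truncated expansion has a leading term that dominates near 0. Applied at the
  points 1 / X m, this takes the place of a zero estimate.\<close>

lemma eventually_nonzero:
  assumes "\<not> vanishing T"
  shows "\<forall>\<^sub>F x in at_right 0. eval2 T x (S x) \<noteq> 0"
proof -
  obtain N where N: "(\<lambda>x. eval2 T x (S x)) \<notin> O[at_right 0](\<lambda>x. x ^ N)"
    using assms by (auto simp: vanishing_def)
  obtain s where "(\<lambda>x. S x - ev s x) \<in> O[at_right 0](\<lambda>x. x ^ N)"
    using S_expansion by blast
  then have T: "(\<lambda>x. eval2 T x (S x) - ev (poly T s) x) \<in> O[at_right 0](\<lambda>x. x ^ N)"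
    by (rule eval2_expansion)
  have "\<not> monom 1 N dvd poly T s"
  proof
    assume "monom 1 N dvd poly T s"
    then have "ev (poly T s) \<in> O[at_right 0](\<lambda>x. x ^ N)"
      by (simp add: ev_bigo_iff)
    from sum_in_bigo(1)[OF T this] show False
      using N by simp
  qed
  moreover from this have "poly T s \<noteq> 0"
    by auto
  then obtain w p' where p: "poly T s = monom 1 w * p'" "coeff p' 0 \<noteq> 0"
    by (rule poly_eq_monom_mult)
  ultimately have "w < N"
    by (metis dvd_mult2 monom_1_dvd_monom_1 not_less)
  from leading_term[OF p this T] eventually_small show ?thesis
  proof eventually_elim
    case (elim x)
    then have "0 < \<bar>real_of_int (coeff p' 0)\<bar> / 2 * x ^ w"
      using p(2) by simp
    with elim have "0 < \<bar>eval2 T x (S x)\<bar>"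
      by linarith
    then show ?case
      by simp
  qed
qed

text \<open>P and Q have 2 K + 2 coefficients, and 2 K + 1 conditions kill the terms z^0, ..., z^(2
  K) of Q s - P. Once the common power of 2 is removed, \<open>vanishing_order_bound\<close> limits
  w from above.\<close>

lemma pade_approximant:
  obtains P Q w h where "degree P \<le> K" "degree Q \<le> K" "2 * K + 1 \<le> w" "w \<le> 2 * K + 2 ^ \<alpha> + 2 ^ \<beta>" "h > 0"
    "\<forall>\<^sub>F x in at_right 0. h / 2 * x ^ w \<le> \<bar>ev Q x * S x - ev P x\<bar> \<and> \<bar>ev Q x * S x - ev P x\<bar> \<le> 2 * h * x ^ w"
proof -
  \<comment> \<open>One more than the largest possible w, so that the leading term of the remainder
    lies below the truncation.\<close>
  define N where "N = 2 * K + 2 ^ \<alpha> + 2 ^ \<beta> + 1"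
  obtain s where s: "(\<lambda>x. S x - ev s x) \<in> O[at_right 0](\<lambda>x. x ^ N)"
    using S_expansion by blast
  define I where "I = (UNIV :: bool set) \<times> {..K}"
  \<comment> \<open>The index \<open>True\<close> marks the coefficients of Q, which multiply s, and
    \<open>False\<close> those of P, which multiply -1.\<close>
  define g where "g t = (if t then s else - 1)" for t
  have "finite I" "2 * K + 1 < card I"
    by (simp_all add: I_def)
  then obtain c where c: "\<exists>i\<in>I. c i \<noteq> 0"
      "\<forall>k < 2 * K + 1. (\<Sum>i\<in>I. c i * coeff (monom 1 (snd i) * g (fst i)) k) = 0"
    by (rule int_linear_system[where a = "\<lambda>k i. coeff (monom 1 (snd i) * g (fst i)) k"]) blast
  define R where "R t = (\<Sum>i\<le>K. monom (c (t, i)) i)" for t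
  have coeff_R: "coeff (R t) i = (if i \<le> K then c (t, i) else 0)" for t i
    by (simp add: R_def coeff_sum)
  have R0: "R False \<noteq> 0 \<or> R True \<noteq> 0"
  proof -
    obtain t i where "i \<le> K" "c (t, i) \<noteq> 0"
      using c(1) by (auto simp: I_def)
    then have "coeff (R t) i \<noteq> 0"
      by (simp add: coeff_R)
    then have "R t \<noteq> 0"
      by auto
    then show ?thesis
      by (cases t) auto
  qed
  have "R True * s - R False = (\<Sum>i\<in>I. smult (c i) (monom 1 (snd i) * g (fst i)))"
  proof -
    have "(\<Sum>i\<in>I. smult (c i) (monom 1 (snd i) * g (fst i))) = (\<Sum>t\<in>UNIV. \<Sum>i\<le>K. smult (c (t, i)) (monom 1 i * g t))"
      by (simp add: I_def sum.cartesian_product case_prod_beta)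
    also have "\<dots> = (\<Sum>t\<in>UNIV. R t * g t)"
      by (simp add: R_def sum_distrib_right smult_monom flip: mult_smult_left)
    also have "\<dots> = R True * s - R False"
      by (simp add: UNIV_bool g_def)
    finally show ?thesis ..
  qed
  then have coeff_0: "coeff (R True * s - R False) k = 0" if "k < 2 * K + 1" for k
    using c(2)[rule_format, OF that] by (simp add: coeff_sum)
  obtain j P Q where PQ: "R False = smult (2 ^ j) P" "R True = smult (2 ^ j) Q" "red P \<noteq> 0 \<or> red Q \<noteq> 0"
    using R0 by (rule red_decomp_pair)
  have deg: "degree P \<le> K" "degree Q \<le> K"
  proof -
    have "degree (R t) \<le> K" for t
      by (intro degree_le) (simp add: coeff_R)
    from this[of False] this[of True] show "degree P \<le> K" "degree Q \<le> K"
      by (simp_all add: PQ)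
  qed
  define U where "U = Q * s - P"
  have coeff_U: "coeff U k = 0" if "k < 2 * K + 1" for k
    using coeff_0[OF that] by (simp add: U_def PQ flip: smult_diff_right)
  have bound: "w \<le> 2 * K + 2 ^ \<alpha> + 2 ^ \<beta>" if "monom 1 w dvd U" "w \<le> N" for w
    using vanishing_order_bound[OF deg PQ(3) S_expansion_functional[OF s] that(1)[unfolded U_def] that(2)] .
  have "\<not> monom 1 N dvd U"
    using bound[of N] by (auto simp: N_def)
  then have "U \<noteq> 0"
    by auto
  then obtain w p' where p: "U = monom 1 w * p'" "coeff p' 0 \<noteq> 0"
    by (rule poly_eq_monom_mult)
  have "w < N"
    using \<open>\<not> monom 1 N dvd U\<close> unfolding p(1) by (metis dvd_mult2 monom_1_dvd_monom_1 not_less)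
  have "w \<le> 2 * K + 2 ^ \<alpha> + 2 ^ \<beta>"
    using \<open>w < N\<close> p(1) by (intro bound) auto
  have "coeff U w \<noteq> 0"
    using p by (simp add: coeff_monom_mult)
  then have "2 * K + 1 \<le> w"
    using coeff_U not_less by blast
  have "(\<lambda>x. (ev Q x * S x - ev P x) - ev U x) \<in> O[at_right 0](\<lambda>x. x ^ N)"
    using bigo_mult_bounded[OF s ev_bounded[of Q]] by (simp add: U_def ev_simps algebra_simps)
  from leading_term[OF p \<open>w < N\<close> this] show thesis
    using that[OF deg \<open>2 * K + 1 \<le> w\<close> \<open>w \<le> 2 * K + 2 ^ \<alpha> + 2 ^ \<beta>\<close>, of "\<bar>real_of_int (coeff p' 0)\<bar>"] p(2)
    by simp
qed

text \<open>Replacing z by z^2 and y by y - r in a relation T of minimal degree d, and clearing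
  denominators, gives another relation V of degree at most d. By minimality V is proportional to T,
  and the coefficients of y^(d-1) yield the rational solution.\<close>

lemma function_transcendence:
  assumes "T \<noteq> 0"
  shows "\<not> vanishing T"
proof
  assume "vanishing T"
  define Dg where "Dg d \<longleftrightarrow> (\<exists>T. T \<noteq> 0 \<and> degree T = d \<and> vanishing T)" for d
  define d where "d = (LEAST d. Dg d)"
  have "Dg (degree T)"
    using assms \<open>vanishing T\<close> by (auto simp: Dg_def)
  then have "Dg d"
    unfolding d_def by (rule LeastI)
  then obtain T where T: "T \<noteq> 0" "degree T = d" "vanishing T"
    by (auto simp: Dg_def)
  have minimal: "W = 0" if "degree W < d" "vanishing W" for W
    using that not_less_Least[of "degree W" Dg] by (auto simp: d_def Dg_def)
  have "d > 0"
  proof (rule ccontr)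
    assume "\<not> d > 0"
    then obtain p where "T = [:p:]"
      using T(2) by (auto elim: degree_eq_zeroE)
    then show False
      using T vanishing_const[of p] by simp
  qed
  then obtain d' where d': "d = Suc d'"
    using gr0_conv_Suc by auto
  \<comment> \<open>L is dn (y - r), which takes the value dn S(x^2) at y = S(x). The factors dn^(d
    - j) in V complete every term to the common factor dn^d.\<close>
  define L where "L = [:- nm, dn:]"
  define V where "V = (\<Sum>j\<le>d. smult (dn ^ (d - j) * sqr (coeff T j)) (L ^ j))"
  define pd where "pd = coeff T d"
  define pd' where "pd' = coeff T d'"
  \<comment> \<open>This combination cancels the coefficient of y^d.\<close>
  define W where "W = smult pd V - smult (sqr pd * dn ^ d) T"
  have "pd \<noteq> 0"
    using T(1,2) by (metis pd_def leading_coeff_0_iff)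
  have V_eq: "eval2 V x (S x) = eval2 T (x\<^sup>2) (S (x\<^sup>2)) * ev (dn ^ d) x" if x: "0 < x" "x \<le> 1 / 2" for x
  proof -
    define y where "y = 1 + of_int e * x ^ 2 ^ \<beta>"
    have "y \<noteq> 0"
      using r_denominator[OF x] by (simp add: y_def)
    have dn: "ev (dn) x = y"
      by (simp add: ev_simps y_def)
    have "eval2 L x (S x) = y * S x - x ^ 2 ^ \<alpha>"
      by (simp add: L_def eval2_simps ev_simps y_def algebra_simps)
    also have "\<dots> = y * (S x - r x)"
      using \<open>y \<noteq> 0\<close> by (simp add: r_def y_def[symmetric] field_simps)
    also have "S x - r x = S (x\<^sup>2)"
      using S_functional[OF x] by simp
    finally have L: "eval2 L x (S x) = y * S (x\<^sup>2)" .
    have "eval2 V x (S x) = (\<Sum>j\<le>d. y ^ (d - j) * ev (coeff T j) (x\<^sup>2) * (y * S (x\<^sup>2)) ^ j)"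
      by (simp only: V_def eval2_simps L of_int_poly_hom.hom_mult of_int_poly_hom.hom_power poly_mult poly_power dn)
        (simp add: ev_simps)
    also have "\<dots> = (\<Sum>j\<le>d. (ev (coeff T j) (x\<^sup>2) * S (x\<^sup>2) ^ j) * y ^ d)"
    proof (rule sum.cong)
      fix j
      assume "j \<in> {..d}"
      then have "y ^ d = y ^ (d - j) * y ^ j"
        by (simp flip: power_add)
      then show "y ^ (d - j) * ev (coeff T j) (x\<^sup>2) * (y * S (x\<^sup>2)) ^ j = (ev (coeff T j) (x\<^sup>2) * S (x\<^sup>2) ^ j) * y ^ d"
        by (simp add: power_mult_distrib)
    qed simp
    also have "\<dots> = eval2 T (x\<^sup>2) (S (x\<^sup>2)) * ev (dn ^ d) x"
      by (simp only: eval2_altdef T(2) sum_distrib_right of_int_poly_hom.hom_power poly_power dn)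
    finally show ?thesis .
  qed
  have "vanishing V"
    unfolding vanishing_def
  proof
    fix N
    have "(\<lambda>x. eval2 T x (S x)) \<in> O[at_right 0](\<lambda>x. x ^ N)"
      using T(3) by (simp add: vanishing_def)
    from bigo_mult_bounded[OF bigo_square[OF this] ev_bounded]
    have "(\<lambda>x. eval2 T (x\<^sup>2) (S (x\<^sup>2)) * ev (dn ^ d) x) \<in> O[at_right 0](\<lambda>x. x ^ N)" .
    also have "?this \<longleftrightarrow> (\<lambda>x. eval2 V x (S x)) \<in> O[at_right 0](\<lambda>x. x ^ N)"
      by (rule landau_o.big.in_cong, rule eventually_mono[OF eventually_small]) (use V_eq in auto)
    finally show "(\<lambda>x. eval2 V x (S x)) \<in> O[at_right 0](\<lambda>x. x ^ N)" .
  qed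
  then have W: "vanishing W"
    using T(3) unfolding vanishing_def W_def eval2_simps
    by (intro allI sum_in_bigo) (simp_all add: mult.commute[of "ev _ _"] bigo_mult_bounded ev_bounded)
  have deg_L: "degree (L ^ j) \<le> j" for j
    by (rule order_trans[OF degree_power_le]) (simp add: L_def)
  have coeff_V: "coeff V d = sqr pd * dn ^ d"
      "coeff V d' = dn * sqr pd' * dn ^ d' + sqr pd * (of_nat d * dn ^ d' * (- nm))"
  proof -
    have "coeff V i = (\<Sum>j\<le>d. dn ^ (d - j) * sqr (coeff T j) * coeff (L ^ j) i)" for i
      by (simp add: V_def coeff_sum)
    also have "\<dots> i = (\<Sum>j\<in>{i..d}. dn ^ (d - j) * sqr (coeff T j) * coeff (L ^ j) i)" for i
      using deg_L by (intro sum.mono_neutral_right) (auto simp: not_le intro!: coeff_eq_0 le_less_trans[OF deg_L])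
    finally have V: "coeff V i = (\<Sum>j\<in>{i..d}. dn ^ (d - j) * sqr (coeff T j) * coeff (L ^ j) i)" for i .
    have L: "coeff (L ^ j) i = of_nat (j choose i) * dn ^ i * (- nm) ^ (j - i)" if "i \<le> j" for i j
      unfolding L_def using that by (rule coeff_linear_poly_power)
    show "coeff V d = sqr pd * dn ^ d"
      by (simp add: V L pd_def)
    have "{d'..d} = {d', d}" "d' \<noteq> d" "d' \<le> d" "d - d' = 1" "d choose d' = d"
      using d' by auto
    then show "coeff V d' = dn * sqr pd' * dn ^ d' + sqr pd * (of_nat d * dn ^ d' * (- nm))"
      by (simp add: V L pd_def pd'_def)
  qed
  have "degree W < d"
  proof (rule degree_lessI)
    have "degree V \<le> d"
      unfolding V_def by (intro degree_sum_le order_trans[OF degree_smult_le]) (auto intro: order_trans[OF deg_L])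
    then have "coeff W k = 0" if "k > d" for k
      using that T(2) by (simp add: W_def coeff_eq_0)
    moreover have "coeff W d = 0"
      by (simp add: W_def coeff_V(1) pd_def mult_ac)
    ultimately show "\<forall>k\<ge>d. coeff W k = 0"
      by (auto simp: le_less)
  qed (use \<open>d > 0\<close> in simp)
  then have "W = 0"
    using W by (rule minimal)
  then have "coeff W d' = 0"
    by simp
  then have W0: "pd * (dn * sqr pd' * dn ^ d' + sqr pd * (of_nat d * dn ^ d' * (- nm)))
      = sqr pd * dn ^ d * pd'"
    by (simp add: W_def coeff_V(2) pd'_def)
  have "dn ^ d' * (pd * dn * sqr pd' - of_nat d * pd * sqr pd * nm - sqr pd * dn * pd') = 0"
  proof -
    have "y * (p * x * A - D * p * B * z - B * x * C) = p * (x * A * y + B * (D * y * (- z))) - B * (x * y) * C"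
      for p x A B C D y z :: "int poly"
      by (simp add: algebra_simps)
    moreover have "dn ^ d = dn * dn ^ d'"
      by (simp add: d')
    ultimately show ?thesis
      using W0 by (simp only: diff_self)
  qed
  moreover have "dn \<noteq> 0"
    using red_dn by force
  ultimately have "pd * dn * sqr pd' - of_nat d * pd * sqr pd * nm - sqr pd * dn * pd' = 0"
    by (metis mult_eq_0_iff power_not_zero)
  then have "of_nat d * (pd * dn * sqr pd' - of_nat d * pd * sqr pd * nm - sqr pd * dn * pd') = 0"
    by simp
  \<comment> \<open>Division by pd * sqr pd * dn turns the relation into f(z^2) - d r - f(z) = 0
    with f = pd' / pd, so that A = - f / d satisfies A(z) = A(z^2) + r.\<close>
  moreover define P Q where "P = - pd'" and "Q = of_nat d * pd"
  moreover have "sqr P = - sqr pd'" "sqr Q = of_nat d * sqr pd"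
    by (simp_all add: P_def Q_def pcompose_hom.hom_uminus pcompose_mult pcompose_hom.hom_of_nat)
  ultimately have "P * sqr Q * dn = sqr P * Q * dn + nm * Q * sqr Q"
    by (simp add: algebra_simps)
  moreover have "Q \<noteq> 0"
    using \<open>pd \<noteq> 0\<close> \<open>d > 0\<close> by (simp add: Q_def)
  ultimately show False
    using no_rational_solution by blast
qed

text \<open>There are (n + 1)^2 coefficients against n^2 vanishing conditions. Transcendence of S as
  a function ensures that the resulting form does not vanish for small x.\<close>

lemma auxiliary_polynomial:
  obtains c :: "nat \<times> nat \<Rightarrow> int" and C
  where "C > 0" "\<forall>\<^sub>F x in at_right 0.
    (\<Sum>i\<in>{..n} \<times> {..n}. of_int (c i) * x ^ fst i * S x ^ snd i) \<noteq> 0 \<and>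
    \<bar>\<Sum>i\<in>{..n} \<times> {..n}. of_int (c i) * x ^ fst i * S x ^ snd i\<bar> \<le> C * x ^ n\<^sup>2"
proof -
  define I where "I = {..n} \<times> {..n}"
  obtain s where s: "(\<lambda>x. S x - ev s x) \<in> O[at_right 0](\<lambda>x. x ^ n\<^sup>2)"
    using S_expansion by blast
  have "finite I" "n\<^sup>2 < card I"
    by (simp_all add: I_def power2_eq_square)
  then obtain c where c: "\<exists>i\<in>I. c i \<noteq> 0" "\<forall>k < n\<^sup>2. (\<Sum>i\<in>I. c i * coeff (monom 1 (fst i) * s ^ snd i) k) = 0"
    by (rule int_linear_system[where a = "\<lambda>k i. coeff (monom 1 (fst i) * s ^ snd i) k"]) blast
  define T where "T = (\<Sum>i\<in>I. monom (monom (c i) (fst i)) (snd i))"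
  have T: "eval2 T x y = (\<Sum>i\<in>I. of_int (c i) * x ^ fst i * y ^ snd i)" for x y
    by (simp add: T_def eval2_simps ev_simps)
  have "coeff (coeff T j) i = (if i \<le> n \<and> j \<le> n then c (i, j) else 0)" for i j
  proof -
    have "coeff (coeff T j) i = (\<Sum>k\<in>I. if k = (i, j) then c k else 0)"
      unfolding T_def coeff_sum coeff_monom by (intro sum.cong) (auto simp: prod_eq_iff)
    also have "\<dots> = (if (i, j) \<in> I then c (i, j) else 0)"
      using \<open>finite I\<close> by simp
    finally show ?thesis
      by (simp add: I_def)
  qed
  moreover obtain i j where "i \<le> n" "j \<le> n" "c (i, j) \<noteq> 0"
    using c(1) by (auto simp: I_def)
  ultimately have "coeff (coeff T j) i \<noteq> 0"
    by simp
  then have "T \<noteq> 0"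
    by auto
  then have nonzero: "\<forall>\<^sub>F x in at_right 0. eval2 T x (S x) \<noteq> 0"
    by (intro eventually_nonzero function_transcendence)
  have "poly T s = (\<Sum>i\<in>I. smult (c i) (monom 1 (fst i) * s ^ snd i))"
    by (simp add: T_def poly_sum poly_monom smult_monom flip: mult_smult_left)
  then have "monom 1 (n\<^sup>2) dvd poly T s"
    using c(2) by (simp add: monom_1_dvd_iff' coeff_sum)
  then have "ev (poly T s) \<in> O[at_right 0](\<lambda>x. x ^ n\<^sup>2)"
    by (simp add: ev_bigo_iff)
  from sum_in_bigo(1)[OF eval2_expansion[OF s, of T] this]
  have "(\<lambda>x. eval2 T x (S x)) \<in> O[at_right 0](\<lambda>x. x ^ n\<^sup>2)"
    by simp
  then obtain C where C: "C > 0" "\<forall>\<^sub>F x in at_right 0. norm (eval2 T x (S x)) \<le> C * norm (x ^ n\<^sup>2)"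
    by (rule landau_o.bigE)
  have "\<forall>\<^sub>F x in at_right 0. eval2 T x (S x) \<noteq> 0 \<and> \<bar>eval2 T x (S x)\<bar> \<le> C * x ^ n\<^sup>2"
    using C(2) nonzero eventually_small by eventually_elim auto
  then show thesis
    using that[OF C(1)] unfolding T I_def by blast
qed

end

section \<open>Irrationality exponents\<close>

definition rational_approximations :: "real \<Rightarrow> real \<Rightarrow> (int \<times> int) set" where
  "rational_approximations \<xi> \<mu> = {pq. let p = fst pq; q = snd pq in q > 0 \<and> coprime p q \<and>
     \<bar>\<xi> - of_int p / of_int q\<bar> < of_int q powr (- \<mu>)}"

text \<open>Dirichlet's theorem: on a finite set of fractions |q \<xi> - p| has a positive minimum,
  and an approximation with error below 1/N smaller than this minimum is a new fraction.\<close>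

lemma infinite_rational_approximations:
  assumes "\<xi> \<notin> \<rat>"
  shows "infinite (rational_approximations \<xi> 2)"
proof
  define Z where "Z = rational_approximations \<xi> 2"
  assume "finite (rational_approximations \<xi> 2)"
  then have fin: "finite Z"
    by (simp add: Z_def)
  \<comment> \<open>The inserted 1 keeps the minimum meaningful when Z is empty.\<close>
  define \<delta> where "\<delta> = Min (insert 1 ((\<lambda>pq. \<bar>of_int (snd pq) * \<xi> - of_int (fst pq)\<bar>) ` Z))"
  have pos: "\<bar>of_int q * \<xi> - of_int p\<bar> > 0" if "(p, q) \<in> Z" for p q
  proof (rule ccontr)
    assume "\<not> \<bar>of_int q * \<xi> - of_int p\<bar> > 0"
    moreover have "q > 0"
      using that by (simp add: Z_def rational_approximations_def Let_def)
    ultimately have "\<xi> = of_int p / of_int q"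
      by (simp add: field_simps)
    then show False
      using assms by auto
  qed
  have "\<delta> > 0"
    unfolding \<delta>_def using fin pos by (subst Min_gr_iff) auto
  then obtain N :: nat where N: "N > 0" "1 / real N < \<delta>"
    using nat_approx_posE[of \<delta>] by (metis of_nat_Suc zero_less_Suc)
  obtain h k where hk: "coprime h k" "0 < k" "k \<le> int N" "\<bar>of_int k * \<xi> - of_int h\<bar> < 1 / N"
    using Dirichlet_approx_coprime[OF N(1), of \<xi>] by blast
  have "\<bar>\<xi> - of_int h / of_int k\<bar> = \<bar>of_int k * \<xi> - of_int h\<bar> / of_int k"
  proof -
    have "\<xi> - of_int h / of_int k = (of_int k * \<xi> - of_int h) / of_int k"
      using hk(2) by (simp add: diff_divide_distrib)
    then show ?thesis
      using hk(2) by (simp add: abs_divide)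
  qed
  also have "\<dots> < (1 / N) / of_int k"
    using hk by (intro divide_strict_right_mono) auto
  also have "\<dots> \<le> (1 / of_int k) / of_int k"
    using hk N(1) by (intro divide_right_mono divide_left_mono) auto
  also have "\<dots> = of_int k powr (- 2)"
    using hk(2) by (simp add: powr_minus powr_numeral power2_eq_square field_simps)
  finally have "(h, k) \<in> Z"
    using hk by (simp add: Z_def rational_approximations_def Let_def)
  then have "\<delta> \<le> \<bar>of_int k * \<xi> - of_int h\<bar>"
    unfolding \<delta>_def using fin by (intro Min_le) force+
  then show False
    using hk(4) N(2) by simp
qed

text \<open>The approximations \<open>p / q\<close> attached to \<open>K\<close> and \<open>m\<close> have denominators of size about \<open>X m ^ K\<close>. Given
  a fraction \<open>a / d\<close>, choosing first \<open>m\<close> and then \<open>K\<close> in a fixed finite range makes \<open>X m ^ K\<close> comparable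
  to \<open>d\<close> up to an arbitrarily small power of \<open>d\<close>.\<close>

lemma finite_rational_approximations:
  fixes \<xi> :: real and b c :: nat
  defines "X \<equiv> \<lambda>m. real b ^ 2 ^ m"
  assumes b: "b \<ge> 2" and \<mu>: "\<mu> > 2"
    and approx: "\<And>K. \<exists>M. \<forall>m\<ge>M. \<exists>p q :: int. \<bar>of_int q\<bar> \<le> X m ^ (K + c) \<and>
      \<bar>of_int q * \<xi> - of_int p\<bar> * X m ^ K \<le> X m ^ c \<and> of_int q * \<xi> \<noteq> of_int p \<and>
      \<bar>of_int q\<bar> \<le> \<bar>of_int q * \<xi> - of_int p\<bar> * X m ^ (2 * K + c)"
  shows "finite (rational_approximations \<xi> \<mu>)"
proof -
  \<comment> \<open>The last condition says |\<xi> - p / q| \<ge> X m ^ -(2 K + c); it serves the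
    case in which the given fraction equals p / q. The threshold M depends on K, so only finitely
    many K may be used.\<close>
  obtain M where M: "\<And>K m. m \<ge> M K \<Longrightarrow> \<exists>p q :: int. \<bar>of_int q\<bar> \<le> X m ^ (K + c) \<and>
      \<bar>of_int q * \<xi> - of_int p\<bar> * X m ^ K \<le> X m ^ c \<and> of_int q * \<xi> \<noteq> of_int p \<and>
      \<bar>of_int q\<bar> \<le> \<bar>of_int q * \<xi> - of_int p\<bar> * X m ^ (2 * K + c)"
    using approx by metis
  \<comment> \<open>j exceeds the exponents 2 c + 4 and 3 c + 4 lost below, and K0 is so large that
    X m ^ K0 \<le> d implies X m ^ j \<le> d^(\<mu> - 2).\<close>
  define j where "j = 4 * c + 5"
  obtain K0 :: nat where K0: "real j / (\<mu> - 2) < real K0"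
    using reals_Archimedean2 by blast
  moreover have "0 \<le> real j / (\<mu> - 2)"
    using \<mu> by simp
  ultimately have "K0 > 0"
    by (cases K0) auto
  \<comment> \<open>The range covers every K = k + c + 1 with k \<le> 2 K0.\<close>
  define M0 where "M0 = Max (M ` {..2 * K0 + c + 1})"
  have M0: "M K \<le> M0" if "K \<le> 2 * K0 + c + 1" for K
    unfolding M0_def using that by (intro Max_ge) auto
  have X2: "X m \<ge> 2" for m
  proof -
    have "(2::real) ^ 1 \<le> 2 ^ 2 ^ m"
      by (intro power_increasing) auto
    also have "\<dots> \<le> X m"
      unfolding X_def using b by (intro power_mono) auto
    finally show ?thesis by simp
  qed
  have X1: "X m > 1" for m
    using X2[of m] by linarith
  have X_Suc: "X (Suc m) = X m ^ 2" for m
    by (simp add: X_def power_mult[symmetric] mult.commute)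
  have X_ge: "X m \<ge> real m" for m
  proof -
    have "real m \<le> real (2 ^ m)"
      by (simp add: less_imp_le[OF less_exp])
    also have "\<dots> \<le> real (2 ^ 2 ^ m)"
      by (intro of_nat_mono power_increasing) (auto simp: less_imp_le[OF less_exp])
    also have "\<dots> \<le> X m"
      unfolding X_def using b by (simp add: power_mono)
    finally show ?thesis .
  qed
  have small: "real_of_int d < X M0 ^ K0" if ad: "(a, d) \<in> rational_approximations \<xi> \<mu>" for a d
  proof (rule ccontr)
    assume "\<not> real_of_int d < X M0 ^ K0"
    then have dM0: "X M0 ^ K0 \<le> real_of_int d"
      by simp
    define y where "y = real_of_int d"
    have d: "d > 0" "y \<ge> 1" and ad': "\<bar>\<xi> - of_int a / y\<bar> < y powr (- \<mu>)"
      using ad by (auto simp: rational_approximations_def Let_def y_def)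
    \<comment> \<open>Since X (Suc m) is the square of X m, this places d between X m ^ K0 and X m ^
      (2 K0), leaving a bounded range for k.\<close>
    have "\<exists>m. M0 \<le> m \<and> X m ^ K0 \<le> y \<and> y < X (Suc m) ^ K0"
    proof -
      define m1 where "m1 = M0 + nat d + 1"
      have "y < real m1"
        using d by (simp add: y_def m1_def)
      also have "\<dots> \<le> X m1"
        by (rule X_ge)
      also have "\<dots> \<le> X m1 ^ K0"
        using \<open>K0 > 0\<close> X1[of m1] by (intro self_le_power) auto
      finally have ex: "\<exists>m. M0 < m \<and> y < X m ^ K0"
        by (intro exI[of _ m1]) (simp add: m1_def)
      define m where "m = (LEAST m. M0 < m \<and> y < X m ^ K0)"
      have m: "M0 < m" "y < X m ^ K0"
        using LeastI_ex[OF ex] by (auto simp: m_def)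
      then obtain m' where m': "m = Suc m'"
        by (cases m) auto
      have "X m' ^ K0 \<le> y"
      proof (cases "m' = M0")
        case True
        then show ?thesis
          using dM0 by (simp add: y_def)
      next
        case False
        then show ?thesis
          using not_less_Least[of m' "\<lambda>m. M0 < m \<and> y < X m ^ K0"] m m' by (auto simp: m_def[symmetric])
      qed
      then show ?thesis
        using m m' by (intro exI[of _ m']) auto
    qed
    then obtain m where m: "M0 \<le> m" "X m ^ K0 \<le> y" "y < X m ^ (2 * K0)"
      by (auto simp: X_Suc simp flip: power_mult)
    define x where "x = X m"
    have x: "x \<ge> 2"
      using X2 by (simp add: x_def)
    define k where "k = (LEAST k. y < x ^ k)"
    have k: "y < x ^ k" "k \<le> 2 * K0"
      unfolding k_def using m(3) by (auto simp: x_def intro: LeastI Least_le)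
    have "k \<noteq> 0"
      using k(1) d by (auto intro: ccontr)
    then obtain k' where k': "k = Suc k'"
      by (cases k) auto
    have k'y: "x ^ k' \<le> y"
      using not_less_Least[of k' "\<lambda>k. y < x ^ k"] k' by (simp add: k_def[symmetric] not_less)
    \<comment> \<open>From y < x^k and x \<ge> 2 follows 2 y x^c \<le> x^K, which makes y |q \<xi> -
      p| at most 1/2.\<close>
    define K where "K = k + c + 1"
    have "m \<ge> M K"
      using M0[of K] m(1) k(2) by (simp add: K_def)
    then obtain p q :: int where pq: "\<bar>of_int q\<bar> \<le> x ^ (K + c)"
        "\<bar>of_int q * \<xi> - of_int p\<bar> * x ^ K \<le> x ^ c" "of_int q * \<xi> \<noteq> of_int p"
        "\<bar>of_int q\<bar> \<le> \<bar>of_int q * \<xi> - of_int p\<bar> * x ^ (2 * K + c)"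
      using M unfolding x_def by blast
    have x_powr: "x ^ i \<le> y powr (\<mu> - 2)" if "i \<le> j" for i
    proof -
      have "x ^ i = (x ^ K0) powr (real i / real K0)"
        using x \<open>K0 > 0\<close> by (simp add: powr_realpow[symmetric] powr_powr)
      also have "\<dots> \<le> y powr (real i / real K0)"
        using m(2) x by (intro powr_mono2) (auto simp: x_def)
      also have "\<dots> \<le> y powr (\<mu> - 2)"
      proof (intro powr_mono)
        have "real i \<le> real j"
          using that by simp
        also have "\<dots> \<le> real K0 * (\<mu> - 2)"
          using K0 \<mu> by (simp add: divide_less_eq less_imp_le)
        finally show "real i / real K0 \<le> \<mu> - 2"
          using \<open>K0 > 0\<close> by (simp add: divide_le_eq mult.commute)
      qed (use d in simp)
      finally show ?thesis .
    qed
    \<comment> \<open>If the fractions differ, the nonzero integer p d - q a would be at most 1/2 +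
      1/4 in absolute value. If they agree, the lower bound for |\<xi> - p / q| contradicts the
      quality of a / d.\<close>
    show False
    proof (cases "p * d = q * a")
      case False
      then have "1 \<le> \<bar>real_of_int (p * d - q * a)\<bar>"
        by linarith
      also have "real_of_int (p * d - q * a) = y * (of_int p - of_int q * \<xi>) + of_int q * (y * (\<xi> - of_int a / y))"
        using d by (simp add: y_def field_simps)
      also have "\<bar>\<dots>\<bar> \<le> y * \<bar>of_int q * \<xi> - of_int p\<bar> + \<bar>of_int q\<bar> * (y * \<bar>\<xi> - of_int a / y\<bar>)"
        using d by (intro order_trans[OF abs_triangle_ineq]) (simp add: abs_mult abs_minus_commute)
      also have "y * \<bar>of_int q * \<xi> - of_int p\<bar> \<le> 1 / 2"
      proof -
        have "2 * y * x ^ c \<le> x * x ^ k * x ^ c"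
          using k(1) x d by (intro mult_mono) auto
        also have "\<dots> = x ^ K"
          by (simp add: K_def power_add)
        finally have "(\<bar>of_int q * \<xi> - of_int p\<bar> * (2 * y)) * x ^ c \<le> 1 * x ^ c"
          using mult_left_mono[of "2 * y * x ^ c" "x ^ K" "\<bar>of_int q * \<xi> - of_int p\<bar>"] pq(2)
          by (simp add: mult.assoc)
        then have "\<bar>of_int q * \<xi> - of_int p\<bar> * (2 * y) \<le> 1"
          by (rule mult_right_le_imp_le) (use x in simp)
        then show ?thesis
          by (simp add: mult.commute)
      qed
      also have "\<bar>of_int q\<bar> * (y * \<bar>\<xi> - of_int a / y\<bar>) \<le> 1 / 4"
      proof -
        have "\<bar>of_int q\<bar> * (y * \<bar>\<xi> - of_int a / y\<bar>) \<le> x ^ (K + c) * (y * y powr (- \<mu>))"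
          using pq(1) ad' d x by (intro mult_mono) auto
        also have "x ^ (K + c) = x ^ k' * x ^ (2 * c + 2)"
          by (simp add: K_def k' power_add mult_2)
        also have "x ^ k' * x ^ (2 * c + 2) * (y * y powr (- \<mu>)) \<le> y * x ^ (2 * c + 2) * (y * y powr (- \<mu>))"
          using k'y x d by (intro mult_right_mono) auto
        also have "\<dots> = x ^ (2 * c + 2) * (y\<^sup>2 * y powr (- \<mu>))"
          by (simp add: power2_eq_square)
        also have "\<dots> = x ^ (2 * c + 2) / y powr (\<mu> - 2)"
          using d by (simp add: powr_diff powr_minus powr_numeral field_simps)
        also have "\<dots> \<le> x ^ (2 * c + 2) / x ^ (2 * c + 4)"
          using x x_powr[of "2 * c + 4"] d by (intro divide_left_mono) (auto simp: j_def)
        also have "\<dots> = 1 / x\<^sup>2"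
          using x by (simp add: power_add power2_eq_square power4_eq_xxxx)
        also have "\<dots> \<le> 1 / 2\<^sup>2"
          using x by (intro divide_left_mono power_mono) auto
        finally show ?thesis
          by simp
      qed
      finally show False
        by simp
    next
      case True
      have "q \<noteq> 0"
      proof
        assume "q = 0"
        then have "p = 0"
          using True d by simp
        then show False
          using pq(3) \<open>q = 0\<close> by simp
      qed
      have eq: "of_int a / y = of_int p / of_int q"
        using True \<open>q \<noteq> 0\<close> d by (simp add: y_def field_simps flip: of_int_mult)
      have "\<bar>of_int q\<bar> * (1 / x ^ (2 * K + c)) \<le> \<bar>of_int q * \<xi> - of_int p\<bar>"
        using pq(4) x by (simp add: divide_le_eq)
      also have "of_int q * \<xi> - of_int p = of_int q * (\<xi> - of_int a / y)"
        using \<open>q \<noteq> 0\<close> by (simp add: eq right_diff_distrib)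
      finally have "\<bar>of_int q\<bar> * (1 / x ^ (2 * K + c)) \<le> \<bar>of_int q\<bar> * \<bar>\<xi> - of_int a / y\<bar>"
        by (simp only: abs_mult)
      then have "1 / x ^ (2 * K + c) \<le> \<bar>\<xi> - of_int a / y\<bar>"
        by (rule mult_left_le_imp_le) (use \<open>q \<noteq> 0\<close> in simp)
      also have "\<dots> < y powr (- \<mu>)"
        by (rule ad')
      also have "\<dots> = 1 / y powr \<mu>"
        by (simp add: powr_minus divide_inverse)
      finally have "y powr \<mu> < x ^ (2 * K + c)"
        using x d by (simp add: divide_less_cancel frac_less2 field_simps)
      also have "\<dots> = (x ^ k')\<^sup>2 * x ^ (3 * c + 4)"
        by (simp add: K_def k' power_add power_mult power2_eq_square power4_eq_xxxx power3_eq_cube mult_2 mult_ac)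
      also have "\<dots> \<le> y\<^sup>2 * y powr (\<mu> - 2)"
        using k'y x d by (intro mult_mono power_mono x_powr) (auto simp: j_def)
      also have "\<dots> = y powr \<mu>"
        using d by (simp add: powr_diff powr_numeral)
      finally show False
        by simp
    qed
  qed
  define N where "N = \<lceil>X M0 ^ K0\<rceil>"
  define B where "B = \<lceil>of_int N * (\<bar>\<xi>\<bar> + 1)\<rceil>"
  have "rational_approximations \<xi> \<mu> \<subseteq> {-B..B} \<times> {0..N}"
  proof
    fix z
    assume z: "z \<in> rational_approximations \<xi> \<mu>"
    obtain a d where ad: "z = (a, d)"
      by (cases z)
    have d: "d > 0" "\<bar>\<xi> - of_int a / of_int d\<bar> < of_int d powr (- \<mu>)"
      using z by (auto simp: ad rational_approximations_def Let_def)
    have "d < N"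
      unfolding N_def less_ceiling_iff by (rule small[OF z[unfolded ad]])
    then have dN: "d \<le> N"
      by simp
    have "of_int d powr (- \<mu>) \<le> real_of_int d powr 0"
      using d(1) \<mu> by (intro powr_mono) auto
    then have "\<bar>\<xi> - of_int a / of_int d\<bar> \<le> 1"
      using d by simp
    then have "\<bar>of_int a / of_int d\<bar> \<le> \<bar>\<xi>\<bar> + 1"
      by linarith
    then have "\<bar>real_of_int a\<bar> \<le> of_int d * (\<bar>\<xi>\<bar> + 1)"
      using d(1) by (simp add: abs_divide divide_le_eq mult.commute)
    also have "\<dots> \<le> of_int N * (\<bar>\<xi>\<bar> + 1)"
      using dN by (intro mult_right_mono) auto
    finally have "\<bar>real_of_int a\<bar> \<le> of_int B"
      unfolding B_def by (meson le_of_int_ceiling order_trans)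
    then have "- B \<le> a" "a \<le> B"
      by linarith+
    moreover have "0 \<le> d"
      using d(1) by linarith
    ultimately show "z \<in> {-B..B} \<times> {0..N}"
      unfolding ad mem_Times_iff atLeastAtMost_iff fst_conv snd_conv using dN by (intro conjI)
  qed
  then show ?thesis
    by (rule finite_subset) simp
qed

lemma irrationality_exponent_eq_2:
  assumes "\<xi> \<notin> \<rat>" and "\<And>\<mu>. \<mu> > 2 \<Longrightarrow> finite (rational_approximations \<xi> \<mu>)"
  shows "irrationality_exponent \<xi> = 2"
proof -
  have eq: "irrationality_exponent \<xi> = Sup {ereal \<mu> | \<mu>. infinite (rational_approximations \<xi> \<mu>)}"
    by (simp add: irrationality_exponent_def rational_approximations_def)
  show ?thesis
    unfolding eq
  proof (rule antisym)
    show "Sup {ereal \<mu> | \<mu>. infinite (rational_approximations \<xi> \<mu>)} \<le> 2"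
    proof (rule Sup_least)
      fix z
      assume "z \<in> {ereal \<mu> | \<mu>. infinite (rational_approximations \<xi> \<mu>)}"
      then obtain \<mu> where "z = ereal \<mu>" "infinite (rational_approximations \<xi> \<mu>)"
        by blast
      then show "z \<le> 2"
        using assms(2)[of \<mu>] by (cases "\<mu> > 2") auto
    qed
    have "ereal 2 \<in> {ereal \<mu> | \<mu>. infinite (rational_approximations \<xi> \<mu>)}"
      using infinite_rational_approximations[OF assms(1)] by blast
    from Sup_upper[OF this] show "2 \<le> Sup {ereal \<mu> | \<mu>. infinite (rational_approximations \<xi> \<mu>)}"
      by simp
  qed
qed

section \<open>Values of the Mahler function\<close>

lemma homogenization:
  fixes Y :: int
  assumes "degree Q \<le> K" "Y \<noteq> 0"
  obtains q :: int where "of_int q = of_int Y ^ K * ev Q (1 / of_int Y)"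
proof
  have "ev Q (1 / of_int Y) = (\<Sum>i\<le>K. of_int (coeff Q i) * (1 / of_int Y) ^ i)"
    unfolding poly_altdef using assms(1)
    by (intro sum.mono_neutral_cong_left) (auto simp: coeff_eq_0)
  moreover have "real_of_int Y ^ (K - i) = of_int Y ^ K * (1 / of_int Y) ^ i" if "i \<le> K" for i
    using that assms(2) by (simp add: power_diff power_divide)
  ultimately show "real_of_int (\<Sum>i\<le>K. coeff Q i * Y ^ (K - i)) = of_int Y ^ K * ev Q (1 / of_int Y)"
    by (simp add: sum_distrib_left mult_ac)
qed

text \<open>A telescoping product of differences of squares. It bounds the denominator of the m-th
  partial sum by a fixed power of X m, although the number of factors grows.\<close>

lemma prod_one_plus_power_two_power:
  "(\<Prod>n<m. t ^ 2 ^ n + 1) * (t - 1) = t ^ 2 ^ m - (1 :: 'a :: comm_ring_1)"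
proof (induction m)
  case (Suc m)
  have "(\<Prod>n<Suc m. t ^ 2 ^ n + 1) * (t - 1) = (t ^ 2 ^ m + 1) * ((\<Prod>n<m. t ^ 2 ^ n + 1) * (t - 1))"
    by (simp add: mult_ac)
  also have "\<dots> = t ^ 2 ^ m * t ^ 2 ^ m - 1"
    unfolding Suc.IH by (simp add: algebra_simps)
  also have "t ^ 2 ^ m * t ^ 2 ^ m = t ^ 2 ^ Suc m"
    by (simp flip: power_add add: mult_2)
  finally show ?case .
qed simp

lemma abs_coeff_linear_power_le:
  fixes A D :: int
  shows "\<bar>coeff ([:A, D:] ^ j) k\<bar> \<le> (\<bar>A\<bar> + \<bar>D\<bar>) ^ j"
proof (induction j arbitrary: k)
  case (Suc j)
  have "coeff ([:A, D:] ^ Suc j) k = A * coeff ([:A, D:] ^ j) k + D * (case k of 0 \<Rightarrow> 0 | Suc i \<Rightarrow> coeff ([:A, D:] ^ j) i)"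
    by (simp add: coeff_pCons split: nat.split)
  also have "\<bar>\<dots>\<bar> \<le> \<bar>A\<bar> * \<bar>coeff ([:A, D:] ^ j) k\<bar> + \<bar>D\<bar> * \<bar>case k of 0 \<Rightarrow> 0 | Suc i \<Rightarrow> coeff ([:A, D:] ^ j) i\<bar>"
    by (intro order_trans[OF abs_triangle_ineq]) (simp add: abs_mult)
  also have "\<dots> \<le> \<bar>A\<bar> * (\<bar>A\<bar> + \<bar>D\<bar>) ^ j + \<bar>D\<bar> * (\<bar>A\<bar> + \<bar>D\<bar>) ^ j"
    using Suc.IH by (intro add_mono mult_left_mono) (auto split: nat.split)
  finally show ?case
    by (simp add: distrib_right)
qed (simp add: coeff_1)

lemma algebraic_of_int_mult:
  fixes x :: real and a :: int
  assumes "algebraic (of_int a * x)" "a \<noteq> 0"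
  shows "algebraic x"
proof -
  obtain p :: "int poly" where p: "p \<noteq> 0" "ev p (of_int a * x) = 0"
    using assms(1) by (rule algebraicE')
  have "ev (pcompose p [:0, a:]) x = 0"
    using p(2) by (simp add: ev_simps mult.commute)
  moreover have "pcompose p [:0, a:] \<noteq> 0"
    using p(1) assms(2) by (simp add: pcompose_eq_0_iff)
  ultimately show ?thesis
    by (intro algebraicI[of "of_int_poly (pcompose p [:0, a:])"]) auto
qed

locale mahler_value = mahler_series +
  fixes b :: nat
  assumes b: "b \<ge> 2"
begin

definition X :: "nat \<Rightarrow> real" where "X m = real b ^ 2 ^ m"

lemma X_ge: "X m \<ge> 2" "X m \<ge> real m"
proof -
  have "m \<le> 2 ^ m" "1 \<le> (2::nat) ^ m"
    by (simp_all add: less_imp_le[OF less_exp])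
  then have "real m \<le> real (2 ^ 2 ^ m)" "real (2 ^ 1) \<le> real (2 ^ 2 ^ m)"
    by (intro of_nat_mono order_trans[OF _ less_imp_le[OF less_exp]]; simp)
      (intro of_nat_mono power_increasing; simp)
  moreover have "real (2 ^ 2 ^ m) \<le> X m"
    unfolding X_def using b by (simp add: power_mono)
  ultimately have "real m \<le> X m" "real (2 ^ 1) \<le> X m"
    by (meson order_trans)+
  then show "X m \<ge> 2" "X m \<ge> real m"
    by simp_all
qed

lemma X_eventually_ge: "\<forall>\<^sub>F m in sequentially. C \<le> X m"
proof -
  have "\<forall>\<^sub>F m in sequentially. C \<le> real m"
    using filterlim_real_sequentially by (simp add: filterlim_at_top)
  then show ?thesis
    by eventually_elim (use X_ge(2) order_trans in blast)
qed

lemma eventually_sequentially_X: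
  assumes "\<forall>\<^sub>F x in at_right 0. P (x::real)"
  shows "\<forall>\<^sub>F m in sequentially. P (1 / X m)"
proof -
  have "filterlim X at_top sequentially"
    using X_eventually_ge by (simp add: filterlim_at_top)
  then have "filterlim (\<lambda>m. inverse (X m)) (at_right 0) sequentially"
    by (rule filterlim_compose[OF filterlim_inverse_at_right_top])
  then show ?thesis
    using assms by (simp add: filterlim_iff divide_inverse)
qed

definition R :: "nat \<Rightarrow> real" where "R m = (\<Sum>n<m. r ((1 / real b) ^ 2 ^ n))"

lemma S_eq: "S (1 / real b) = R m + S (1 / X m)"
  using S_iterate[of "1 / real b" m] b by (simp add: R_def X_def power_divide)

text \<open>A common denominator of R m: with u = b^(2^(n+\<beta>)) and v = b^(2^(n+\<alpha>)) the
  n-th summand is u / (v (u + e)), and every v divides b^(2^(m+\<alpha>)).\<close>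

definition D :: "nat \<Rightarrow> int" where
  "D m = int b ^ 2 ^ (m + \<alpha>) * (\<Prod>n<m. int b ^ 2 ^ (n + \<beta>) + e)"

lemma factor_pos: "int b ^ 2 ^ k + e \<ge> 1"
proof -
  have "(2::int) ^ 1 \<le> 2 ^ 2 ^ k"
    by (intro power_increasing) auto
  also have "\<dots> \<le> int b ^ 2 ^ k"
    using b by (intro power_mono) auto
  finally show ?thesis
    using e by auto
qed

lemma D_ge_1: "D m \<ge> 1"
proof -
  have "0 < (\<Prod>n<m. int b ^ 2 ^ (n + \<beta>) + e)"
  proof (rule prod_pos)
    show "0 < int b ^ 2 ^ (n + \<beta>) + e" for n
      using factor_pos[of "n + \<beta>"] by linarith
  qed
  moreover have "0 < int b ^ 2 ^ (m + \<alpha>)"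
    using b by simp
  ultimately have "0 < D m"
    unfolding D_def by (rule mult_pos_pos[rotated])
  then show ?thesis
    by simp
qed

lemma D_le: "of_int (D m) \<le> X m ^ (2 ^ \<alpha> + 2 ^ \<beta>)"
proof -
  define t where "t = int b ^ 2 ^ \<beta>"
  have t: "t ^ 2 ^ n = int b ^ 2 ^ (n + \<beta>)" for n
    by (simp add: t_def power_mult[symmetric] power_add mult.commute)
  have t2: "t \<ge> 2"
  proof -
    have "(2::int) ^ 1 \<le> 2 ^ 2 ^ \<beta>"
      by (intro power_increasing) auto
    also have "\<dots> \<le> t"
      unfolding t_def using b by (intro power_mono) auto
    finally show ?thesis by simp
  qed
  have pos: "0 \<le> (\<Prod>n<m. t ^ 2 ^ n + 1)"
    using t2 by (intro prod_nonneg) auto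
  have "(\<Prod>n<m. int b ^ 2 ^ (n + \<beta>) + e) \<le> (\<Prod>n<m. t ^ 2 ^ n + 1)"
    using e factor_pos unfolding t by (intro prod_mono) (auto intro: order_trans[OF zero_le_one])
  also have "\<dots> \<le> (\<Prod>n<m. t ^ 2 ^ n + 1) * (t - 1)"
    using pos t2 mult_left_mono[of 1 "t - 1"] by force
  also have "\<dots> \<le> t ^ 2 ^ m"
    by (simp add: prod_one_plus_power_two_power)
  finally have "D m \<le> int b ^ 2 ^ (m + \<alpha>) * int b ^ 2 ^ (m + \<beta>)"
    unfolding D_def t by (intro mult_left_mono) auto
  then have "real_of_int (D m) \<le> real_of_int (int b ^ 2 ^ (m + \<alpha>) * int b ^ 2 ^ (m + \<beta>))"
    by (rule of_int_le_iff[THEN iffD2])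
  also have "\<dots> = X m ^ (2 ^ \<alpha> + 2 ^ \<beta>)"
    by (simp add: X_def power_add power_mult)
  finally show ?thesis .
qed

lemma D_R_int: obtains A :: int where "of_int A = of_int (D m) * R m"
proof -
  have "of_int (D m) * r ((1 / real b) ^ 2 ^ n) \<in> \<int>" if n: "n < m" for n
  proof -
    define u v where "u = int b ^ 2 ^ (n + \<beta>)" and "v = int b ^ 2 ^ (n + \<alpha>)"
    define w where "w = int b ^ (2 ^ (m + \<alpha>) - 2 ^ (n + \<alpha>))"
    define t where "t = u + e"
    define p where "p = (\<Prod>k\<in>{..<m} - {n}. int b ^ 2 ^ (k + \<beta>) + e)"
    have "(2::nat) ^ (n + \<alpha>) \<le> 2 ^ (m + \<alpha>)"
      using n by (intro power_increasing) auto
    then have "int b ^ 2 ^ (m + \<alpha>) = w * v"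
      by (simp add: w_def v_def flip: power_add)
    moreover have "(\<Prod>k<m. int b ^ 2 ^ (k + \<beta>) + e) = (u + e) * p"
      unfolding p_def u_def using n by (subst prod.remove[of _ n]) auto
    ultimately have D: "D m = w * v * (t * p)"
      by (simp add: D_def t_def)
    have pos: "u > 0" "v > 0" "t > 0"
      using b factor_pos[of "n + \<beta>"] by (simp_all add: u_def v_def t_def)
    have t: "real_of_int t = of_int u + of_int e"
      by (simp add: t_def)
    have pw: "((1 / real b) ^ 2 ^ n) ^ 2 ^ k = 1 / of_int (int b ^ 2 ^ (n + k))" for k
      by (simp add: power_divide power_mult[symmetric] power_add)
    have "r ((1 / real b) ^ 2 ^ n) = (1 / of_int v) / (1 + of_int e * (1 / of_int u))"
      by (simp add: r_def pw u_def v_def)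
    also have "\<dots> = of_int u / (of_int v * of_int t)"
      using pos t by (simp add: field_simps)
    finally have "of_int (D m) * r ((1 / real b) ^ 2 ^ n) = of_int (D m) * (of_int u / (of_int v * of_int t))"
      by simp
    also have "\<dots> = of_int (w * p * u)"
      unfolding D using pos by (simp add: field_simps)
    finally show ?thesis
      by simp
  qed
  then have "of_int (D m) * R m \<in> \<int>"
    unfolding R_def sum_distrib_left by (intro Ints_sum) auto
  then show thesis
    using that by (elim Ints_cases) auto
qed

text \<open>The Pade remainder E is evaluated at x = 1 / X m, where S(x) = S(1/b) - R m. The factor
  X m ^ K clears the denominators of P(x) and Q(x), and D m that of R m. The two bounds on w become
  the upper and lower bounds for |q \<xi> - p|.\<close>

lemma value_approximations:
  fixes B :: int
  assumes B: "B \<ge> 1"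
  defines "c \<equiv> 2 ^ \<alpha> + 2 ^ \<beta> + 1" and "\<xi> \<equiv> of_int B * S (1 / real b)"
  shows "\<exists>M. \<forall>m\<ge>M. \<exists>p q :: int. \<bar>of_int q\<bar> \<le> X m ^ (K + c) \<and>
      \<bar>of_int q * \<xi> - of_int p\<bar> * X m ^ K \<le> X m ^ c \<and> of_int q * \<xi> \<noteq> of_int p \<and>
      \<bar>of_int q\<bar> \<le> \<bar>of_int q * \<xi> - of_int p\<bar> * X m ^ (2 * K + c)"
  unfolding eventually_sequentially[symmetric]
proof -
  define c1 :: nat where "c1 = 2 ^ \<alpha> + 2 ^ \<beta>"
  obtain P Q w h where PQ: "degree P \<le> K" "degree Q \<le> K" and w: "2 * K + 1 \<le> w" "w \<le> 2 * K + c1" and h: "h > 0"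
    and E: "\<forall>\<^sub>F x in at_right 0. h / 2 * x ^ w \<le> \<bar>ev Q x * S x - ev P x\<bar> \<and> \<bar>ev Q x * S x - ev P x\<bar> \<le> 2 * h * x ^ w"
    unfolding c1_def by (rule pade_approximant[of K]) (simp add: add.assoc)
  obtain C where C: "C > 0" "\<forall>\<^sub>F x in at_right 0. norm (ev Q x) \<le> C * norm (1::real)"
    using ev_bounded[of Q] by (rule landau_o.bigE)
  show "\<forall>\<^sub>F m in sequentially. \<exists>p q :: int. \<bar>of_int q\<bar> \<le> X m ^ (K + c) \<and>
      \<bar>of_int q * \<xi> - of_int p\<bar> * X m ^ K \<le> X m ^ c \<and> of_int q * \<xi> \<noteq> of_int p \<and>
      \<bar>of_int q\<bar> \<le> \<bar>of_int q * \<xi> - of_int p\<bar> * X m ^ (2 * K + c)"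
    \<comment> \<open>The three thresholds absorb the constants C, 2 h B and 2 C / h into one factor
      X m each; this is the summand 1 in c.\<close>
    using eventually_sequentially_X[OF E] eventually_sequentially_X[OF C(2)]
      X_eventually_ge[of C] X_eventually_ge[of "of_int B * (2 * h)"] X_eventually_ge[of "2 * C / h"]
  proof eventually_elim
    case (elim m)
    define x where "x = 1 / X m"
    define E where "E = ev Q x * S x - ev P x"
    have X: "X m > 0" "X m \<ge> 2" "X m \<ge> 1"
      using X_ge(1)[of m] by simp_all
    have Xx: "X m ^ i * x ^ i = 1" for i
      using X(1) by (simp add: x_def power_divide)
    have x: "x > 0" "x \<le> 1"
      using X by (simp_all add: x_def)
    have E_bounds: "h / 2 * x ^ w \<le> \<bar>E\<bar>" "\<bar>E\<bar> \<le> 2 * h * x ^ w"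
      using elim(1) by (simp_all add: E_def x_def)
    have Q_bound: "\<bar>ev Q x\<bar> \<le> C"
      using elim(2) by (simp add: x_def)
    have XY: "X m = of_int (int b ^ 2 ^ m)" "int b ^ 2 ^ m \<noteq> 0"
      using b by (simp_all add: X_def)
    obtain A where A: "of_int A = of_int (D m) * R m"
      by (rule D_R_int)
    obtain qq :: int where qq: "of_int qq = X m ^ K * ev Q x"
      using homogenization[OF PQ(2) XY(2)] unfolding x_def XY(1) by blast
    obtain pp :: int where pp: "of_int pp = X m ^ K * ev P x"
      using homogenization[OF PQ(1) XY(2)] unfolding x_def XY(1) by blast
    \<comment> \<open>The factor B is part of \<xi> and therefore appears only in p; then q \<xi> -
      p = B D m X m ^ K E.\<close>
    define q p where "q = D m * qq" and "p = B * (A * qq + D m * pp)"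
    have D: "1 \<le> real_of_int (D m)" "real_of_int (D m) \<le> X m ^ c1"
      using D_ge_1[of m] D_le[of m] by (simp_all add: c1_def)
    have diff: "of_int q * \<xi> - of_int p = of_int B * (of_int (D m) * (X m ^ K * E))"
      by (simp add: q_def p_def \<xi>_def S_eq[of m] A qq pp E_def x_def algebra_simps)
    have abs_diff: "\<bar>of_int q * \<xi> - of_int p\<bar> = of_int B * (of_int (D m) * (X m ^ K * \<bar>E\<bar>))"
      unfolding diff using B D X by (simp add: abs_mult)
    have abs_q: "\<bar>of_int q\<bar> = of_int (D m) * (X m ^ K * \<bar>ev Q x\<bar>)"
      using D X by (simp add: q_def qq abs_mult)
    have c: "c = c1 + 1"
      by (simp add: c_def c1_def)
    have 1: "\<bar>of_int q\<bar> \<le> X m ^ (K + c)"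
    proof -
      have "\<bar>of_int q\<bar> \<le> X m ^ c1 * (X m ^ K * X m)"
        unfolding abs_q using D X Q_bound elim(3) by (intro mult_mono) auto
      then show ?thesis
        by (simp add: c power_add mult_ac)
    qed
    have 2: "\<bar>of_int q * \<xi> - of_int p\<bar> * X m ^ K \<le> X m ^ c"
    proof -
      have "x ^ w \<le> x ^ (2 * K + 1)"
        using w(1) x by (intro power_decreasing) auto
      then have "\<bar>E\<bar> \<le> 2 * h * x ^ (2 * K + 1)"
        using E_bounds(2) h by (meson mult_left_mono less_imp_le mult_pos_pos order_trans zero_less_numeral)
      then have "\<bar>of_int q * \<xi> - of_int p\<bar> \<le> of_int B * (X m ^ c1 * (X m ^ K * (2 * h * x ^ (2 * K + 1))))"
        unfolding abs_diff using D X B by (intro mult_mono) auto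
      then have "\<bar>of_int q * \<xi> - of_int p\<bar> * X m ^ K \<le> of_int B * (X m ^ c1 * (X m ^ K * (2 * h * x ^ (2 * K + 1)))) * X m ^ K"
        using X by (intro mult_right_mono) auto
      also have "\<dots> = X m ^ c1 * (of_int B * (2 * h)) * (X m ^ (2 * K) * x ^ (2 * K)) * x"
      proof -
        have "x ^ (2 * K + 1) = x ^ (2 * K) * x" "X m ^ (2 * K) = X m ^ K * X m ^ K"
          by (simp_all add: mult_2 power_add)
        then show ?thesis
          by (simp only: mult_ac)
      qed
      also have "\<dots> = X m ^ c1 * ((of_int B * (2 * h)) * x)"
        unfolding Xx by simp
      also have "\<dots> \<le> X m ^ c1 * (X m * 1)"
        using elim(4) x X B h by (intro mult_left_mono mult_mono) auto
      finally show ?thesis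
        by (simp add: c mult.commute)
    qed
    have "0 < h / 2 * x ^ w"
      using h x by simp
    then have "0 < \<bar>E\<bar>"
      using E_bounds(1) by linarith
    then have "of_int q * \<xi> - of_int p \<noteq> 0"
      unfolding diff using B D X by auto
    then have 3: "of_int q * \<xi> \<noteq> of_int p"
      by simp
    have 4: "\<bar>of_int q\<bar> \<le> \<bar>of_int q * \<xi> - of_int p\<bar> * X m ^ (2 * K + c)"
    proof -
      have "C \<le> h / 2 * X m"
        using elim(5) h by (simp add: divide_le_eq mult.commute)
      also have "\<dots> = h / 2 * (X m * (X m ^ (2 * K + c1) * x ^ (2 * K + c1)))"
        unfolding Xx by simp
      also have "\<dots> \<le> h / 2 * (X m * (X m ^ (2 * K + c1) * x ^ w))"
        using w(2) x X h by (intro mult_left_mono power_decreasing) auto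
      also have "\<dots> = (h / 2 * x ^ w) * X m ^ (2 * K + c)"
        by (simp add: c power_add mult_ac)
      also have "\<dots> \<le> \<bar>E\<bar> * X m ^ (2 * K + c)"
        using E_bounds(1) X by (intro mult_right_mono) auto
      finally have "\<bar>ev Q x\<bar> \<le> \<bar>E\<bar> * X m ^ (2 * K + c)"
        using Q_bound by linarith
      then have "\<bar>of_int q\<bar> \<le> of_int (D m) * (X m ^ K * (\<bar>E\<bar> * X m ^ (2 * K + c)))"
        unfolding abs_q using D X by (intro mult_left_mono) auto
      also have "\<dots> \<le> of_int B * (of_int (D m) * (X m ^ K * (\<bar>E\<bar> * X m ^ (2 * K + c))))"
        using B D X mult_right_mono[of 1 "real_of_int B"] by force
      finally show ?thesis
        unfolding abs_diff by (simp add: mult.assoc)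
    qed
    show ?case
      using 1 2 3 4 by blast
  qed
qed

text \<open>Substituting S(x) = \<xi> - R m into the auxiliary form at x = 1 / X m and clearing
  denominators gives an integer polynomial U with U(\<xi>) = X m ^ n * D m ^ n * E. The order n^2 of
  E beats the Liouville bound, in which all exponents are linear in n.\<close>

lemma value_transcendental: "\<not> algebraic (S (1 / real b))"
proof
  define \<xi> where "\<xi> = S (1 / real b)"
  assume "algebraic (S (1 / real b))"
  then obtain d where liouville: "\<forall>n. \<exists>\<kappa>>0. \<forall>U H. degree U \<le> n \<longrightarrow> (\<forall>i. \<bar>of_int (coeff U i)\<bar> \<le> H) \<longrightarrow>
      ev U \<xi> \<noteq> 0 \<longrightarrow> \<kappa> \<le> \<bar>ev U \<xi>\<bar> * H ^ d"
    unfolding \<xi>_def by (rule algebraic_liouville) blast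
  define c :: nat where "c = 2 ^ \<alpha> + 2 ^ \<beta>"
  \<comment> \<open>The Liouville bound loses X m ^ (n (c + 1) (d + 1)) in total, so this n is the
    least one for which n^2 wins; a factor x^n remains.\<close>
  define n where "n = (c + 1) * (d + 1) + 1"
  obtain \<kappa> where \<kappa>: "\<kappa> > 0" "\<forall>U H. degree U \<le> n \<longrightarrow> (\<forall>i. \<bar>of_int (coeff U i)\<bar> \<le> H) \<longrightarrow>
      ev U \<xi> \<noteq> 0 \<longrightarrow> \<kappa> \<le> \<bar>ev U \<xi>\<bar> * H ^ d"
    using liouville[THEN spec, of n] by blast
  define I where "I = {..n} \<times> {..n}"
  obtain a :: "nat \<times> nat \<Rightarrow> int" and C where C: "C > 0" and aux: "\<forall>\<^sub>F x in at_right 0.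
    (\<Sum>i\<in>I. of_int (a i) * x ^ fst i * S x ^ snd i) \<noteq> 0 \<and>
    \<bar>\<Sum>i\<in>I. of_int (a i) * x ^ fst i * S x ^ snd i\<bar> \<le> C * x ^ n\<^sup>2"
    unfolding I_def by (rule auxiliary_polynomial)
  \<comment> \<open>The 5 comes from |A| + D m \<le> 5 D m, a consequence of |R m| \<le> 4.\<close>
  define C1 where "C1 = (\<Sum>i\<in>I. \<bar>real_of_int (a i)\<bar>) * 5 ^ n"
  have C1: "C1 \<ge> 0"
    by (simp add: C1_def sum_nonneg)
  have "\<forall>\<^sub>F m in sequentially. False"
    using eventually_sequentially_X[OF aux] X_eventually_ge[of "C * C1 ^ d / \<kappa> + 1"]
  proof eventually_elim
    case (elim m)
    define x where "x = 1 / X m"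
    define E where "E = (\<Sum>i\<in>I. of_int (a i) * x ^ fst i * S x ^ snd i)"
    have E: "E \<noteq> 0" "\<bar>E\<bar> \<le> C * x ^ n\<^sup>2"
      using elim(1) by (simp_all add: E_def x_def)
    have X: "X m > 0" "X m \<ge> 2" "X m \<ge> 1"
      using X_ge(1)[of m] by simp_all
    have Xx: "X m ^ i * x ^ i = 1" for i
      using X(1) by (simp add: x_def power_divide)
    have x: "x > 0" "x \<le> 1 / 2"
      using X by (simp_all add: x_def)
    define Y where "Y = int b ^ 2 ^ m"
    have XY: "X m = of_int Y"
      by (simp add: X_def Y_def)
    obtain A where A: "of_int A = of_int (D m) * R m"
      by (rule D_R_int)
    have D: "1 \<le> real_of_int (D m)" "real_of_int (D m) \<le> X m ^ c"
      using D_ge_1[of m] D_le[of m] by (simp_all add: c_def)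
    \<comment> \<open>At \<xi> the linear factor takes the value D m S(x); the powers of Y and D m
      bring all terms to the common factor X m ^ n * D m ^ n.\<close>
    define U where "U = (\<Sum>i\<in>I. smult (a i * Y ^ (n - fst i) * D m ^ (n - snd i)) ([:- A, D m:] ^ snd i))"
    have "of_int (D m) * \<xi> - of_int A = of_int (D m) * S x"
      unfolding \<xi>_def A S_eq[of m] by (simp add: x_def algebra_simps)
    then have lin: "ev [:- A, D m:] \<xi> = of_int (D m) * S x"
      by (simp add: ev_simps mult.commute)
    have "ev U \<xi> = (\<Sum>i\<in>I. of_int (a i * Y ^ (n - fst i) * D m ^ (n - snd i)) * (of_int (D m) * S x) ^ snd i)"
      unfolding U_def of_int_poly_hom.hom_sum poly_sum of_int_hom.map_poly_hom_smult poly_smult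
        of_int_poly_hom.hom_power poly_power lin ..
    also have "\<dots> = (\<Sum>i\<in>I. (X m ^ n * of_int (D m) ^ n) * (of_int (a i) * x ^ fst i * S x ^ snd i))"
    proof (rule sum.cong)
      fix i
      assume "i \<in> I"
      then have i: "fst i \<le> n" "snd i \<le> n"
        by (auto simp: I_def)
      have 1: "X m ^ (n - fst i) = X m ^ n * x ^ fst i"
        using i X by (simp add: x_def power_diff power_divide)
      have 2: "real_of_int (D m) ^ n = of_int (D m) ^ (n - snd i) * of_int (D m) ^ snd i"
        using i by (simp flip: power_add)
      show "of_int (a i * Y ^ (n - fst i) * D m ^ (n - snd i)) * (of_int (D m) * S x) ^ snd i =
          (X m ^ n * of_int (D m) ^ n) * (of_int (a i) * x ^ fst i * S x ^ snd i)"
        by (simp only: of_int_mult of_int_power XY[symmetric] 1 2 power_mult_distrib mult_ac)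
    qed simp
    also have "\<dots> = X m ^ n * of_int (D m) ^ n * E"
      by (simp add: E_def sum_distrib_left)
    finally have U: "ev U \<xi> = X m ^ n * of_int (D m) ^ n * E" .
    have "\<bar>R m\<bar> \<le> 4"
    proof -
      have "\<bar>S (1 / real b)\<bar> \<le> 4 * (1 / real b)"
        using b by (intro S_bound) (auto simp: field_simps)
      also have "\<dots> \<le> 2"
        using b by (simp add: field_simps)
      finally have "\<bar>S (1 / real b)\<bar> \<le> 2" .
      moreover have "\<bar>S x\<bar> \<le> 2"
        using S_bound[OF x] x by linarith
      moreover have "S (1 / real b) = R m + S x"
        using S_eq[of m] by (simp add: x_def)
      ultimately show ?thesis
        by linarith
    qed
    then have "\<bar>real_of_int A\<bar> \<le> of_int (D m) * 4"
      unfolding A using D by (simp add: abs_mult)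
    then have AD: "\<bar>real_of_int A\<bar> + of_int (D m) \<le> 5 * of_int (D m)"
      by simp
    have deg: "degree U \<le> n"
      unfolding U_def
    proof (intro degree_sum_le)
      fix i
      assume "i \<in> I"
      then have "degree ([:- A, D m:] ^ snd i) \<le> n"
        by (intro order_trans[OF degree_power_le]) (auto simp: I_def)
      then show "degree (smult (a i * Y ^ (n - fst i) * D m ^ (n - snd i)) ([:- A, D m:] ^ snd i)) \<le> n"
        by (rule order_trans[OF degree_smult_le])
    qed (simp add: I_def)
    have coeffs: "\<bar>of_int (coeff U k)\<bar> \<le> C1 * X m ^ (n * (c + 1))" for k
    proof -
      have "\<bar>real_of_int (coeff U k)\<bar> \<le> (\<Sum>i\<in>I. \<bar>of_int (a i * Y ^ (n - fst i) * D m ^ (n - snd i) * coeff ([:- A, D m:] ^ snd i) k)\<bar>)"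
        by (simp add: U_def coeff_sum sum_abs)
      also have "\<dots> \<le> (\<Sum>i\<in>I. \<bar>of_int (a i)\<bar> * (X m ^ n * (5 ^ n * of_int (D m) ^ n)))"
      proof (rule sum_mono)
        fix i
        assume "i \<in> I"
        then have i: "fst i \<le> n" "snd i \<le> n"
          by (auto simp: I_def)
        have "\<bar>real_of_int (coeff ([:- A, D m:] ^ snd i) k)\<bar> \<le> of_int ((\<bar>- A\<bar> + \<bar>D m\<bar>) ^ snd i)"
          using abs_coeff_linear_power_le[of "- A" "D m" "snd i" k] by (simp only: of_int_abs[symmetric] of_int_le_iff)
        also have "\<dots> = (\<bar>real_of_int A\<bar> + of_int (D m)) ^ snd i"
          using D by simp
        also have "\<dots> \<le> (5 * of_int (D m)) ^ snd i"
          using AD D by (intro power_mono) auto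
        finally have lin: "\<bar>real_of_int (coeff ([:- A, D m:] ^ snd i) k)\<bar> \<le> 5 ^ snd i * of_int (D m) ^ snd i"
          by (simp add: power_mult_distrib)
        have "\<bar>real_of_int (a i * Y ^ (n - fst i) * D m ^ (n - snd i) * coeff ([:- A, D m:] ^ snd i) k)\<bar>
            = \<bar>of_int (a i)\<bar> * (X m ^ (n - fst i) * (of_int (D m) ^ (n - snd i) * \<bar>real_of_int (coeff ([:- A, D m:] ^ snd i) k)\<bar>))"
          using D X by (simp add: abs_mult XY power_abs)
        also have "\<dots> \<le> \<bar>of_int (a i)\<bar> * (X m ^ n * (of_int (D m) ^ (n - snd i) * (5 ^ n * of_int (D m) ^ snd i)))"
          using D X i lin
          by (intro mult_left_mono mult_mono power_increasing order_trans[OF lin] mult_right_mono) auto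
        also have "of_int (D m) ^ (n - snd i) * (5 ^ n * of_int (D m) ^ snd i) = 5 ^ n * real_of_int (D m) ^ n"
          using i by (simp flip: power_add add: mult.left_commute)
        finally show "\<bar>real_of_int (a i * Y ^ (n - fst i) * D m ^ (n - snd i) * coeff ([:- A, D m:] ^ snd i) k)\<bar>
            \<le> \<bar>of_int (a i)\<bar> * (X m ^ n * (5 ^ n * of_int (D m) ^ n))" .
      qed
      also have "\<dots> = C1 * (X m ^ n * of_int (D m) ^ n)"
        unfolding C1_def sum_distrib_right[symmetric] by (simp only: mult_ac)
      also have "\<dots> \<le> C1 * (X m ^ n * (X m ^ c) ^ n)"
        using D X C1 by (intro mult_left_mono power_mono) auto
      also have "X m ^ n * (X m ^ c) ^ n = X m ^ (n * (c + 1))"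
        by (simp add: power_add mult.commute flip: power_mult)
      finally show ?thesis .
    qed
    have "ev U \<xi> \<noteq> 0"
      unfolding U using E(1) D X by simp
    from \<kappa>(2)[rule_format, OF deg coeffs this]
    have "\<kappa> \<le> \<bar>ev U \<xi>\<bar> * (C1 * X m ^ (n * (c + 1))) ^ d" .
    also have "\<bar>ev U \<xi>\<bar> = X m ^ n * of_int (D m) ^ n * \<bar>E\<bar>"
      unfolding U using D X by (simp add: abs_mult)
    also have "\<dots> \<le> X m ^ n * (X m ^ c) ^ n * (C * x ^ n\<^sup>2)"
      using D X E(2) by (intro mult_mono power_mono) auto
    also have "X m ^ n * (X m ^ c) ^ n = X m ^ (n * (c + 1))"
      by (simp add: power_add mult.commute flip: power_mult)
    finally have "\<kappa> \<le> X m ^ (n * (c + 1)) * (C * x ^ n\<^sup>2) * (C1 * X m ^ (n * (c + 1))) ^ d"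
      using X C1 by (simp add: mult_right_mono)
    also have "\<dots> = C * C1 ^ d * (X m ^ (n * (c + 1)) * (X m ^ (n * (c + 1))) ^ d * x ^ n\<^sup>2)"
      by (simp add: power_mult_distrib mult_ac)
    also have "X m ^ (n * (c + 1)) * (X m ^ (n * (c + 1))) ^ d = X m ^ (n * (c + 1) * (d + 1))"
      by (simp only: power_mult[symmetric] power_add[symmetric]) (simp add: algebra_simps)
    also have "n\<^sup>2 = n * (c + 1) * (d + 1) + n"
      by (simp add: n_def power2_eq_square algebra_simps)
    also have "X m ^ (n * (c + 1) * (d + 1)) * x ^ (n * (c + 1) * (d + 1) + n) = x ^ n"
      unfolding power_add mult.assoc[symmetric] Xx by simp
    also have "C * C1 ^ d * x ^ n \<le> C * C1 ^ d * x ^ 1"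
      using C C1 x by (intro mult_left_mono power_decreasing) (auto simp: n_def)
    finally have "\<kappa> \<le> C * C1 ^ d / X m"
      by (simp add: x_def)
    then have "X m \<le> C * C1 ^ d / \<kappa>"
      using X \<kappa>(1) by (simp add: field_simps)
    then show False
      using elim(2) by simp
  qed
  then show False
    by simp
qed

lemma scaled_value:
  fixes B :: int
  assumes "B \<ge> 1"
  shows "\<not> algebraic (of_int B * S (1 / real b))"
    and "irrationality_exponent (of_int B * S (1 / real b)) = 2"
proof -
  show alg: "\<not> algebraic (of_int B * S (1 / real b))"
    using value_transcendental algebraic_of_int_mult assms by fastforce
  show "irrationality_exponent (of_int B * S (1 / real b)) = 2"
  proof (rule irrationality_exponent_eq_2)
    show "of_int B * S (1 / real b) \<notin> \<rat>"
      using alg rat_imp_algebraic by blast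
  next
    fix \<mu> :: real
    assume "\<mu> > 2"
    then show "finite (rational_approximations (of_int B * S (1 / real b)) \<mu>)"
      by (rule finite_rational_approximations[OF b])
        (use value_approximations[OF assms] in \<open>simp only: X_def\<close>)
  qed
qed

end

theorem theorem2p3:
  fixes \<alpha> \<beta> :: nat and b :: int
  assumes "\<beta> \<noteq> \<alpha> + 1" and "b \<ge> 2"
  shows "\<not> algebraic (F_ab \<alpha> \<beta> (1 / of_int b)) \<and> \<not> algebraic (G_ab \<alpha> \<beta> (1 / of_int b)) \<and>
         irrationality_exponent (F_ab \<alpha> \<beta> (1 / of_int b)) = 2 \<and>
         irrationality_exponent (G_ab \<alpha> \<beta> (1 / of_int b)) = 2"
proof -
  \<comment> \<open>The value at z = 1/b of the prefactor 1 / z^(2^\<alpha>), an integer by which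
    S(1/b) is scaled.\<close>
  define B where "B = b ^ 2 ^ \<alpha>"
  have B: "B \<ge> 1"
    using assms(2) by (simp add: B_def)
  have b: "real (nat b) = of_int b"
    using assms(2) by simp
  have rF: "z ^ 2 ^ (n + \<alpha>) / (1 + z ^ 2 ^ (n + \<beta>)) = mahler_series.r \<alpha> \<beta> 1 (z ^ 2 ^ n)"
    and rG: "z ^ 2 ^ (n + \<alpha>) / (1 - z ^ 2 ^ (n + \<beta>)) = mahler_series.r \<alpha> \<beta> (- 1) (z ^ 2 ^ n)"
    if "mahler_series \<alpha> \<beta> 1" "mahler_series \<alpha> \<beta> (- 1)" for z n
    by (simp_all add: mahler_series.r_def[OF that(1)] mahler_series.r_def[OF that(2)] power_add power_mult)
  interpret F: mahler_value \<alpha> \<beta> 1 "nat b"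
    by unfold_locales (use assms in auto)
  interpret G: mahler_value \<alpha> \<beta> "- 1" "nat b"
    by unfold_locales (use assms in auto)
  have F: "F_ab \<alpha> \<beta> (1 / of_int b) = of_int B * F.S (1 / real (nat b))"
    unfolding F_ab_def F.S_def b B_def rF[OF F.mahler_series_axioms G.mahler_series_axioms]
    by (simp add: power_divide)
  have G: "G_ab \<alpha> \<beta> (1 / of_int b) = of_int B * G.S (1 / real (nat b))"
    unfolding G_ab_def G.S_def b B_def rG[OF F.mahler_series_axioms G.mahler_series_axioms]
    by (simp add: power_divide)
  show ?thesis
    unfolding F G using F.scaled_value[OF B] G.scaled_value[OF B] by blast
qed

end
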